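(* Consider the Bayesian spanning forest model with oracle partition described in the context, with data in $\mathbb R^{p_n}$ and $f^{(n)}_{st}=(\sqrt{2\pi}\sigma_n)^{-p_n}\exp\{-\|y_s-y_t\|_2^2/(2\sigma_n^2)\}$, $\sigma_n>0$. For each $n$, suppose $y_1,\dots,y_n$ are independent with $y_i\sim \mathrm N(\mu_k,\Sigma_k)$ whenever $i\in V_k^{0,n}$. Set $\rho_n:=(\delta_n\lambda_n\sigma_n^{p_n})^{-1}$, $\Lambda_{\max}:=\max_{k\in[K_{0,n}]}\lambda_{\max}(\Sigma_k)$, where $\lambda_{\max}(\Sigma_k)$ is the largest eigenvalue of $\Sigma_k$, and $D_{\mu,\min}:=\min_{k,\ell\in[K_{0,n}],\,k\ne\ell}\|\mu_k-\mu_\ell\|_2$. Assume that (i) there exist constants $C_1,C_2>0$ such that for all sufficiently large $n$, $C_1\delta_n\le \min_{i\in[n]} r_n(y_i)\le\max_{i\in[n]} r_n(y_i)\le C_2\delta_n$; and $K_{0,n}=o(\sqrt n)$; (ii) for a fixed constant $\iota>0$, $\rho_n\succsim (K_{0,n}+1+\iota)^n$, i.e. there is a constant $c>0$ with $\rho_n\ge c\,(K_{0,n}+1+\iota)^n$ for all sufficiently large $n$; (iii) $\sigma_n^2\log(\rho_n)/D_{\mu,\min}^2=o(1)$; (iv) $\Lambda_{\max}\,(p_n\vee\log n)/[\sigma_n^2\log(\rho_n)]=o(1)$. Then $$\mathbb E_{P_0^{(n)}}\big[\Pi(\mathcal V_n\not\sim(V_1^{0,n},\dots,V_{K_{0,n}}^{0,n})\mid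 y^{(n)})\big]\to0\quad\text{as } n\to\infty ,$$ where $P_0^{(n)}$ is the law of $y^{(n)}=(y_1,\dots,y_n)$.
   Context: Oracle. $(V_1^0,V_2^0,\dots)$ is a fixed partition of the positive integers into disjoint sets. For each $n$, $[n]=\{1,\dots,n\}$, $V_k^{0,n}=V_k^0\cap[n]$, and $K_{0,n}$ is the number of nonempty sets among these, labelled $k=1,\dots,K_{0,n}$; $K_{0,n}$ may stay bounded or diverge. Data for different $n$ form a triangular array and need not be nested. The dimension $p_n$ is allowed to grow slowly with $n$ (no explicit rate is specified beyond condition (iv)), and the oracle parameters $\mu_k$ and $\Sigma_k$ (positive definite) may also vary with $n$. When $K_{0,n}=1$, the minimum defining $D_{\mu,\min}$ is over an empty set and is read as $+\infty$. BSF model. For each $n$ there are weights $f^{(n)}_{st}$ as in the claim ($s\ne t$), a positive root kernel $r_n$, and numbers $\delta_n>0$, $\lambda_n>0$. For nonempty $V\subset[n]$, $L_V$ is the graph Laplacian on $V$ with edge weights $f^{(n)}_{st}$ (off-diagonal entries $-f^{(n)}_{st}$, diagonal entries $\sum_{t\in V,t\neq s}f^{(n)}_{st}$), and $|L_V[1]|$ is the determinant of $L_V$ with first row and column removed (equal to $1$ if $|V|=1$). The integrated posterior on ordered partitions $(V_1,\dots,V_K)$ of $[n]$ into $K$ nonempty sets, $K\in\{1,\dots,n\}$, is $$\Pi^*(\mathcal V_n=(V_1,\dots,V_K)\mid y^{(n)})=C_n\prod_{k=1}^K\Big[\lambda_n\Big(\sum_{i\in V_k}r_n(y_i)\Big)|L_{V_k}[1]|\Big],$$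 with $C_n$ the normalizing constant. Two ordered partitions are equivalent ($\sim$) if they agree up to relabelling of blocks; $\Pi(\mathcal V_n\sim(V_1,\dots,V_K)\mid y^{(n)})=K!\,\Pi^*(\mathcal V_n=(V_1,\dots,V_K)\mid y^{(n)})$, and $\Pi(\mathcal V_n\not\sim\cdot\mid y^{(n)})=1-\Pi(\mathcal V_n\sim\cdot\mid y^{(n)})$.
   Formalization: The dimension p_n, said only to grow slowly, is assumed to satisfy p_n = o(n); with no rate beyond (iv) the claim fails, e.g. for K_{0,n}=1, Σ=I, p_n=n, σ_n²=n³, r_n=δ_n=1, ρ_n=2.1^n. *)

theory Defs
  imports
    "HOL-Probability.Probability"
    "HOL-Library.Disjoint_Sets"
    "HOL-Library.Landau_Symbols"
    "HOL-Combinatorics.Multiset_Permutations"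
    "Jordan_Normal_Form.Determinant"
    "Jordan_Normal_Form.Gauss_Jordan_Elimination"
    "Jordan_Normal_Form.Spectral_Radius"
begin

section \<open>Euclidean space of variable dimension and Gaussian laws\<close>

text \<open>
  The dimension varies with the sample size, so it cannot be a type.  Points of the
  \<open>p\<close>-dimensional space are functions \<open>x :: nat \<Rightarrow> real\<close> of which only the coordinates
  \<open>x 0, \<dots>, x (p - 1)\<close> matter; \<open>euclid p\<close> is that space with its Borel sets and Lebesgue
  measure.
\<close>

definition euclid :: "nat \<Rightarrow> (nat \<Rightarrow> real) measure" where
  "euclid p = (\<Pi>\<^sub>M j\<in>{..<p}. lborel)"

definition euclid_dist :: "nat \<Rightarrow> (nat \<Rightarrow> real) \<Rightarrow> (nat \<Rightarrow> real) \<Rightarrow> real" where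
  "euclid_dist p x y = L2_set (\<lambda>j. x j - y j) {..<p}"

definition pos_def_mat :: "nat \<Rightarrow> real mat \<Rightarrow> bool" where
  "pos_def_mat p S \<longleftrightarrow> S \<in> carrier_mat p p \<and> transpose_mat S = S \<and>
     (\<forall>v\<in>carrier_vec p. v \<noteq> 0\<^sub>v p \<longrightarrow> scalar_prod v (S *\<^sub>v v) > 0)"

definition max_eigenvalue :: "real mat \<Rightarrow> real" where
  "max_eigenvalue S = Max (spectrum S)"

definition mvn_density :: "nat \<Rightarrow> (nat \<Rightarrow> real) \<Rightarrow> real mat \<Rightarrow> (nat \<Rightarrow> real) \<Rightarrow> real" where
  "mvn_density p \<mu> S x =
     (let d = Matrix.vec p (\<lambda>j. x j - \<mu> j)
      in exp (- scalar_prod d (the (mat_inverse S) *\<^sub>v d) / 2)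
           / sqrt ((2 * pi) ^ p * Determinant.det S))"


section \<open>The oracle partition\<close>

text \<open>
  Sets \<open>V0 k\<close> are allowed to be empty, so that a partition into finitely many sets is covered
  as well.  The nonempty traces on \<open>{1..n}\<close> are relabelled \<open>1, \<dots>, K0 V0 n\<close> in increasing order
  of their original labels.
\<close>

definition oracle_family :: "(nat \<Rightarrow> nat set) \<Rightarrow> bool" where
  "oracle_family V0 \<longleftrightarrow> disjoint_family_on V0 {1..} \<and> (\<Union>k\<in>{1..}. V0 k) = {1..}"

definition oracle_labels :: "(nat \<Rightarrow> nat set) \<Rightarrow> nat \<Rightarrow> nat set" where
  "oracle_labels V0 n = {k\<in>{1..}. V0 k \<inter> {1..n} \<noteq> {}}"

definition K0 :: "(nat \<Rightarrow> nat set) \<Rightarrow> nat \<Rightarrow> nat" where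
  "K0 V0 n = card (oracle_labels V0 n)"

definition oracle_block :: "(nat \<Rightarrow> nat set) \<Rightarrow> nat \<Rightarrow> nat \<Rightarrow> nat set" where
  "oracle_block V0 n k = V0 (sorted_list_of_set (oracle_labels V0 n) ! (k - 1)) \<inter> {1..n}"

definition oracle_partition :: "(nat \<Rightarrow> nat set) \<Rightarrow> nat \<Rightarrow> nat set list" where
  "oracle_partition V0 n = map (oracle_block V0 n) [1..<Suc (K0 V0 n)]"

definition \<Lambda>_max :: "nat \<Rightarrow> (nat \<Rightarrow> real mat) \<Rightarrow> real" where
  "\<Lambda>_max K \<Sigma> = (MAX k\<in>{1..K}. max_eigenvalue (\<Sigma> k))"

text \<open>Taken in \<open>ereal\<close>, so that the empty minimum (\<open>K = 1\<close>) is \<open>\<infinity>\<close>.\<close>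

definition D_min :: "nat \<Rightarrow> nat \<Rightarrow> (nat \<Rightarrow> nat \<Rightarrow> real) \<Rightarrow> ereal" where
  "D_min p K \<mu> =
     (INF (k, l)\<in>{(k, l). k \<in> {1..K} \<and> l \<in> {1..K} \<and> k \<noteq> l}. ereal (euclid_dist p (\<mu> k) (\<mu> l)))"


section \<open>The Bayesian spanning forest model\<close>

definition edge_weight :: "nat \<Rightarrow> real \<Rightarrow> (nat \<Rightarrow> nat \<Rightarrow> real) \<Rightarrow> nat \<Rightarrow> nat \<Rightarrow> real" where
  "edge_weight p \<sigma> y s t =
     exp (- (euclid_dist p (y s) (y t))\<^sup>2 / (2 * \<sigma>\<^sup>2)) / (sqrt (2 * pi) * \<sigma>) ^ p"

text \<open>Row and column \<open>a\<close> of the Laplacian belong to the \<open>a\<close>-th smallest element of \<open>V\<close>.\<close>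

definition laplacian :: "(nat \<Rightarrow> nat \<Rightarrow> real) \<Rightarrow> nat set \<Rightarrow> real mat" where
  "laplacian f V =
     (let vs = sorted_list_of_set V
      in Matrix.mat (card V) (card V)
           (\<lambda>(a, b). if a = b then \<Sum>t\<in>V - {vs ! a}. f (vs ! a) t else - f (vs ! a) (vs ! b)))"

definition laplacian_minor :: "(nat \<Rightarrow> nat \<Rightarrow> real) \<Rightarrow> nat set \<Rightarrow> real" where
  "laplacian_minor f V = Determinant.det (mat_delete (laplacian f V) 0 0)"

definition ordered_partitions :: "nat \<Rightarrow> nat set list set" where
  "ordered_partitions n = {Vs. distinct Vs \<and> partition_on {1..n} (set Vs)}"

definition bsf_weight ::
  "nat \<Rightarrow> real \<Rightarrow> real \<Rightarrow> ((nat \<Rightarrow> real) \<Rightarrow> real) \<Rightarrow> (nat \<Rightarrow> nat \<Rightarrow> real) \<Rightarrow> nat set list \<Rightarrow> real" where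
  "bsf_weight p \<sigma> lam r y Vs =
     (\<Prod>V\<leftarrow>Vs. lam * (\<Sum>i\<in>V. r (y i)) * laplacian_minor (edge_weight p \<sigma> y) V)"

definition bsf_posterior ::
  "nat \<Rightarrow> nat \<Rightarrow> real \<Rightarrow> real \<Rightarrow> ((nat \<Rightarrow> real) \<Rightarrow> real) \<Rightarrow> (nat \<Rightarrow> nat \<Rightarrow> real) \<Rightarrow> nat set list \<Rightarrow> real" where
  "bsf_posterior n p \<sigma> lam r y Vs =
     bsf_weight p \<sigma> lam r y Vs / (\<Sum>Ws\<in>ordered_partitions n. bsf_weight p \<sigma> lam r y Ws)"

definition bsf_prob_equiv ::
  "nat \<Rightarrow> nat \<Rightarrow> real \<Rightarrow> real \<Rightarrow> ((nat \<Rightarrow> real) \<Rightarrow> real) \<Rightarrow> (nat \<Rightarrow> nat \<Rightarrow> real) \<Rightarrow> nat set list \<Rightarrow> real" where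
  "bsf_prob_equiv n p \<sigma> lam r y Vs = fact (length Vs) * bsf_posterior n p \<sigma> lam r y Vs"

definition bsf_prob_not_equiv ::
  "nat \<Rightarrow> nat \<Rightarrow> real \<Rightarrow> real \<Rightarrow> ((nat \<Rightarrow> real) \<Rightarrow> real) \<Rightarrow> (nat \<Rightarrow> nat \<Rightarrow> real) \<Rightarrow> nat set list \<Rightarrow> real" where
  "bsf_prob_not_equiv n p \<sigma> lam r y Vs = 1 - bsf_prob_equiv n p \<sigma> lam r y Vs"


section \<open>Consistency of the definitions\<close>

text \<open>
  The factor \<open>fact K\<close> is the size of the relabelling class: the ordered partitions that agree
  with \<open>Vs\<close> up to relabelling are the permutations of its set of blocks.
\<close>

lemma bsf_prob_equiv_eq_sum:
  assumes "Vs \<in> ordered_partitions n"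
  shows "bsf_prob_equiv n p \<sigma> lam r y Vs =
           (\<Sum>Ws | Ws \<in> ordered_partitions n \<and> set Ws = set Vs. bsf_posterior n p \<sigma> lam r y Ws)"
proof -
  have d: "distinct Vs" and pt: "partition_on {1..n} (set Vs)"
    using assms by (auto simp: ordered_partitions_def)
  have eq: "{Ws. Ws \<in> ordered_partitions n \<and> set Ws = set Vs} = permutations_of_set (set Vs)"
    using pt by (auto simp: ordered_partitions_def permutations_of_set_def)
  have "bsf_posterior n p \<sigma> lam r y Ws = bsf_posterior n p \<sigma> lam r y Vs"
    if "Ws \<in> permutations_of_set (set Vs)" for Ws
  proof -
    have "mset Ws = mset Vs"
      using that d by (auto simp: permutations_of_set_def set_eq_iff_mset_eq_distinct)
    then have "bsf_weight p \<sigma> lam r y Ws = bsf_weight p \<sigma> lam r y Vs"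
      by (simp add: bsf_weight_def flip: prod_mset_prod_list)
    then show ?thesis by (simp add: bsf_posterior_def)
  qed
  then show ?thesis
    by (simp add: eq bsf_prob_equiv_def distinct_card[OF d])
qed

lemma finite_oracle_labels:
  assumes "oracle_family V0"
  shows "finite (oracle_labels V0 n)"
proof (rule finite_subset)
  let ?g = "\<lambda>i. THE k. k \<in> {1..} \<and> i \<in> V0 k"
  show "oracle_labels V0 n \<subseteq> ?g ` {1..n}"
  proof
    fix k assume "k \<in> oracle_labels V0 n"
    then obtain i where i: "k \<in> {1..}" "i \<in> V0 k" "i \<in> {1..n}"
      unfolding oracle_labels_def by blast
    have "l = k" if "l \<in> {1..} \<and> i \<in> V0 l" for l
      using assms that i unfolding oracle_family_def disjoint_family_on_def by blast
    then have "?g i = k" using i by (intro the_equality conjI)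
    then show "k \<in> ?g ` {1..n}" using i by blast
  qed
qed simp

lemma oracle_partition_in_ordered_partitions:
  assumes "oracle_family V0"
  shows "oracle_partition V0 n \<in> ordered_partitions n"
proof -
  let ?I = "oracle_labels V0 n" and ?B = "\<lambda>k. V0 k \<inter> {1..n}"
  let ?xs = "sorted_list_of_set ?I"
  note fin = finite_oracle_labels[OF assms, of n]
  have eq: "oracle_partition V0 n = map ?B ?xs"
    by (rule nth_equalityI)
       (auto simp: oracle_partition_def oracle_block_def K0_def simp del: upt_Suc)
  have disj: "?B k \<inter> ?B l = {}" if "k \<in> ?I" "l \<in> ?I" "k \<noteq> l" for k l
    using assms that by (auto simp: oracle_family_def disjoint_family_on_def oracle_labels_def)
  have ne: "?B k \<noteq> {}" if "k \<in> ?I" for k using that by (auto simp: oracle_labels_def)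
  have inj: "inj_on ?B ?I"
  proof (rule inj_onI, rule ccontr)
    fix k l assume "k \<in> ?I" "l \<in> ?I" "?B k = ?B l" "k \<noteq> l"
    with disj[of k l] ne[of k] show False by simp
  qed
  have cover: "(\<Union>k\<in>?I. ?B k) = {1..n}"
  proof
    show "{1..n} \<subseteq> (\<Union>k\<in>?I. ?B k)"
    proof
      fix i assume i: "i \<in> {1..n}"
      then have "i \<in> (\<Union>k\<in>{1..}. V0 k)" using assms by (auto simp: oracle_family_def)
      then obtain k where "k \<in> {1..}" "i \<in> V0 k" by blast
      with i show "i \<in> (\<Union>k\<in>?I. ?B k)" unfolding oracle_labels_def by blast
    qed
  qed auto
  have "partition_on {1..n} (?B ` ?I)"
  proof (rule partition_onI)
    show "\<Union> (?B ` ?I) = {1..n}" by (rule cover)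
    show "disjnt X Y" if "X \<in> ?B ` ?I" "Y \<in> ?B ` ?I" "X \<noteq> Y" for X Y
      using that disj unfolding disjnt_def by blast
    show "{} \<notin> ?B ` ?I" using ne by blast
  qed
  then show ?thesis
    using fin inj by (simp add: eq ordered_partitions_def distinct_map)
qed

end

theory Submission
  imports Defs "HOL-Real_Asymp.Real_Asymp"
begin

text \<open>
  By the matrix tree theorem the weight of a partition is a sum over spanning forests, one rooted
  tree per block, of products of root weights \<open>lam * r (y i)\<close> and edge weights.  Hence the
  normalizing constant is at most a sum over all rooted forests on \<open>{1..n}\<close>, weighted by the
  factorial of the number of trees.  With high probability an edge between two oracle blocks weighs at
  most \<open>\<tau>\<close> times a root and a root at most \<open>\<eta>\<close> times an edge inside an oracle block, with
  \<open>\<tau>\<close> and \<open>\<eta>\<close> exponentially small in \<open>n\<close>.  Cutting the edges between oracle blocks and joining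
  the surplus trees inside each block turns any forest into one of the oracle partition, and a
  forest of the oracle partition arises in this way from forests of total weight at most
  \<open>(1 + n * \<tau> + n * \<eta> * (1 + \<tau>)) ^ n\<close> times its own.  So the posterior mass
  outside the oracle partition is at most \<open>n * (n * \<tau> + n * \<eta> * (1 + \<tau>))\<close>, which tends to \<open>0\<close>.
  The high probability event only restricts the distance of each observation from its mean, and a
  union bound over the observations suffices.
\<close>

text \<open>A root weighs \<open>1 / (\<rho> * \<sigma> ^ p)\<close> up to constants, and an edge of
  length d weighs \<open>exp (- d^2 / (2 * \<sigma>^2)) / \<sigma> ^ p\<close> up to a factor
  \<open>sqrt (2 * pi) ^ p\<close>. Without that factor they balance at d^2 = 2
  \<open>\<sigma>^2 * ln \<rho>\<close>. Assumption (iii) puts distinct means far above this scale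
  and (iv) keeps the noise far below it; these two margins make \<tau> and \<eta> negative powers of
  \<rho>, up to constants and, in \<eta>, the factor \<open>sqrt (2 * pi) ^ p\<close>, which the
  slow growth of p controls. The obstacle is that the number of competing partitions, like the
  number of trees on a block, grows faster than any exponential, while \<rho> is only known to be at
  least exponential in n. Multiplying that number by the gain of a single change need not give a
  small bound. Charging each change of a forest to the vertex where it happens replaces the count by
  n local choices, each costing only a power of n. This works because the root is one more possible
  parent: the weight of a forest is then a product over vertices, and passing to another forest
  exchanges single factors.\<close>

section \<open>The matrix tree theorem\<close>

text \<open>A rank function exists iff iterating \<open>\<pi>\<close> from any point eventually leaves \<open>I\<close>, i.e. iff the
  parent map \<open>\<pi>\<close> has no cycle.\<close>

definition ranked_on :: "'a set \<Rightarrow> ('a \<Rightarrow> 'a) \<Rightarrow> bool" where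
  "ranked_on I \<pi> \<longleftrightarrow> (\<exists>h :: 'a \<Rightarrow> nat. \<forall>i\<in>I. \<pi> i \<in> I \<longrightarrow> h (\<pi> i) < h i)"

text \<open>A nonzero term of the Leibniz sum needs a permutation \<open>q\<close> with
  \<open>q i\<close> equal to \<open>i\<close> or \<open>\<pi> i\<close>, so \<open>q\<close> never
  raises the rank \<open>h\<close>. Permuting preserves the total rank, so \<open>q\<close> never
  lowers it either and must be the identity. Its term is 1 because a ranked map has no fixed
  point.\<close>

lemma det_id_minus_ranked:
  assumes "ranked_on {0..<m} \<pi>"
  shows "Determinant.det (Matrix.mat m m (\<lambda>(i, j). of_bool (i = j) - of_bool (\<pi> i = j))) = (1 :: real)"
proof -
  obtain h :: "nat \<Rightarrow> nat" where h: "\<And>i. i < m \<Longrightarrow> \<pi> i < m \<Longrightarrow> h (\<pi> i) < h i"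
    using assms unfolding ranked_on_def by (metis atLeastLessThan_iff zero_le)
  let ?A = "Matrix.mat m m (\<lambda>(i, j). of_bool (i = j) - of_bool (\<pi> i = j)) :: real mat"
  have zero: "(\<Prod>i = 0..<m. ?A $$ (i, q i)) = 0" if q: "q permutes {0..<m}" "q \<noteq> id" for q
  proof (rule ccontr)
    assume "(\<Prod>i = 0..<m. ?A $$ (i, q i)) \<noteq> 0"
    then have nz: "?A $$ (i, q i) \<noteq> 0" if "i < m" for i using that by auto
    have qm: "q i < m" if "i < m" for i using q(1) that permutes_in_image by fastforce
    have alt: "q i = i \<or> q i = \<pi> i" if "i < m" for i
      using nz[OF that] that qm[OF that] by (auto split: if_splits)
    have le: "h (q i) \<le> h i" if "i < m" for i
      using alt[OF that] h[OF that] qm[OF that] by fastforce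
    obtain i where i: "q i \<noteq> i" using q(2) by (auto simp: fun_eq_iff)
    then have im: "i < m" using q(1) by (metis atLeastLessThan_iff permutes_not_in zero_le)
    have "h (q i) < h i" using alt[OF im] h[OF im] qm[OF im] i by metis
    with le im have "(\<Sum>i=0..<m. h (q i)) < (\<Sum>i=0..<m. h i)"
      by (intro sum_strict_mono_ex1) auto
    moreover have "(\<Sum>i=0..<m. h (q i)) = (\<Sum>i=0..<m. h i)"
      using sum.permute[OF q(1), of h] by (simp add: comp_def)
    ultimately show False by simp
  qed
  have np: "\<pi> i \<noteq> i" if "i < m" for i using h[of i] that by force
  have "Determinant.det ?A = (\<Sum>q | q permutes {0..<m}. signof q * (\<Prod>i = 0..<m. ?A $$ (i, q i)))"
    by (rule det_def') auto
  also have "\<dots> = (\<Sum>q\<in>{id}. signof q * (\<Prod>i = 0..<m. ?A $$ (i, q i)))"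
    by (rule sum.mono_neutral_right)
       (use zero in \<open>auto simp: permutes_id finite_permutations simp del: index_mat\<close>)
  also have "\<dots> = 1" using np by (auto intro!: prod.neutral)
  finally show ?thesis .
qed

text \<open>The indicator of the points that never leave \<open>{0..<m}\<close> lies in the kernel.\<close>

lemma det_id_minus_unranked:
  assumes "\<not> ranked_on {0..<m} \<pi>"
  shows "Determinant.det (Matrix.mat m m (\<lambda>(i, j). of_bool (i = j) - of_bool (\<pi> i = j))) = (0 :: real)"
proof -
  let ?A = "Matrix.mat m m (\<lambda>(i, j). of_bool (i = j) - of_bool (\<pi> i = j)) :: real mat"
  define C where "C = {i. \<forall>k. (\<pi> ^^ k) i < m}"
  have "\<exists>i. i \<in> C"
  proof (rule ccontr)
    assume "\<nexists>i. i \<in> C"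
    then have ex: "\<exists>k. \<not> (\<pi> ^^ k) i < m" for i by (auto simp: C_def)
    \<comment> \<open>If every point eventually leaves, the exit time drops along
      \<open>\<pi>\<close> and is a rank function.\<close>
    define h where "h i = (LEAST k. \<not> (\<pi> ^^ k) i < m)" for i
    have "h (\<pi> i) < h i" if "i < m" for i
    proof -
      have "\<not> (\<pi> ^^ h i) i < m" unfolding h_def by (rule LeastI_ex[OF ex])
      moreover have "h i \<noteq> 0" using calculation that by (metis funpow_0)
      then obtain k where k: "h i = Suc k" using not0_implies_Suc by blast
      ultimately have "\<not> (\<pi> ^^ k) (\<pi> i) < m" by (simp add: funpow_swap1)
      then have "h (\<pi> i) \<le> k" unfolding h_def by (rule Least_le)
      then show ?thesis using k by simp
    qed
    then have "ranked_on {0..<m} \<pi>" by (auto simp: ranked_on_def intro!: exI[of _ h])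
    with assms show False by simp
  qed
  then obtain c where c: "c \<in> C" by auto
  have cm: "i < m" if "i \<in> C" for i
    using that unfolding C_def by (auto dest: spec[of _ 0])
  \<comment> \<open>Since \<open>\<pi>\<close> preserves membership in \<open>C\<close> in both
    directions, the two contributions to row \<open>i\<close> cancel on the indicator of
    \<open>C\<close>.\<close>
  have step: "\<pi> i \<in> C \<longleftrightarrow> i \<in> C" if "i < m" for i
  proof
    assume "i \<in> C"
    then have "(\<pi> ^^ Suc k) i < m" for k unfolding C_def by blast
    then show "\<pi> i \<in> C" unfolding C_def by (simp add: funpow_Suc_right del: funpow.simps)
  next
    assume "\<pi> i \<in> C"
    then have "(\<pi> ^^ Suc k) i < m" for k unfolding C_def by (simp add: funpow_Suc_right del: funpow.simps)
    then have "(\<pi> ^^ k) i < m" for k using that by (cases k) simp_all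
    then show "i \<in> C" unfolding C_def by blast
  qed
  let ?v = "Matrix.vec m (\<lambda>i. of_bool (i \<in> C)) :: real vec"
  have "?A *\<^sub>v ?v = 0\<^sub>v m"
  proof (rule eq_vecI)
    fix i assume "i < dim_vec (0\<^sub>v m :: real vec)"
    then have i: "i < m" by simp
    have "(?A *\<^sub>v ?v) $ i = (\<Sum>j=0..<m. (of_bool (i = j) - of_bool (\<pi> i = j)) * of_bool (j \<in> C))"
      using i by (auto simp: scalar_prod_def intro!: sum.cong)
    also have "\<dots> = (\<Sum>j=0..<m. if j = i then of_bool (i \<in> C) else 0) - (\<Sum>j=0..<m. if j = \<pi> i then of_bool (\<pi> i \<in> C) else 0)"
      unfolding sum_subtractf[symmetric] by (intro sum.cong) auto
    also have "\<dots> = 0" using i cm step[OF i] by (auto simp: sum.delta)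
    finally show "(?A *\<^sub>v ?v) $ i = 0\<^sub>v m $ i" using i by simp
  qed simp
  moreover have "?v \<noteq> 0\<^sub>v m" 
  proof
    assume "?v = 0\<^sub>v m"
    then have "?v $ c = 0\<^sub>v m $ c" by simp
    then show False using c cm[OF c] by simp
  qed
  ultimately show ?thesis
    by (subst det_0_iff_vec_prod_zero[of _ m]) (auto intro!: exI[of _ ?v])
qed

text \<open>Index \<open>m\<close> is the root, with \<open>e\<^sub>m = 0\<close>: row \<open>i\<close> of the matrix is the sum over \<open>k\<close> of
  \<open>G i k (e\<^sub>i - e\<^sub>k)\<close>, and the determinant is expanded by multilinearity.\<close>

lemma det_forest_expansion:
  fixes G :: "nat \<Rightarrow> nat \<Rightarrow> real"
  shows "Determinant.det (Matrix.mat m m (\<lambda>(i, j). if i = j then \<Sum>k\<in>{0..m} - {i}. G i k else - G i j)) =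
    (\<Sum>\<pi> | \<pi> \<in> (\<Pi>\<^sub>E i\<in>{0..<m}. {0..m}) \<and> ranked_on {0..<m} \<pi>. \<Prod>i\<in>{0..<m}. G i (\<pi> i))"
proof -
  let ?A = "Matrix.mat m m (\<lambda>(i, j). if i = j then \<Sum>k\<in>{0..m} - {i}. G i k else - G i j)"
  let ?I = "\<lambda>\<pi>. Matrix.mat m m (\<lambda>(i, j). of_bool (i = j) - of_bool (\<pi> i = j)) :: real mat"
  let ?F = "\<Pi>\<^sub>E i\<in>{0..<m}. {0..m}"
  have entry: "?A $$ (i, j) = (\<Sum>k\<in>{0..m}. G i k * (of_bool (i = j) - of_bool (k = j)))"
    if ij: "i < m" "j < m" for i j
  proof (cases "i = j")
    case True
    then show ?thesis using ij by (auto simp: sum.remove[of _ j] intro!: sum.cong)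
  next
    case False
    then have "(\<Sum>k\<in>{0..m}. G i k * (of_bool (i = j) - of_bool (k = j))) =
       (\<Sum>k\<in>{0..m}. if k = j then - G i j else 0)"
      by (intro sum.cong) auto
    then show ?thesis using ij False by (auto simp: sum.delta)
  qed
  have "Determinant.det ?A = (\<Sum>q | q permutes {0..<m}. signof q * (\<Prod>i = 0..<m. ?A $$ (i, q i)))"
    by (rule det_def') auto
  also have "\<dots> = (\<Sum>q | q permutes {0..<m}. signof q * (\<Prod>i = 0..<m.
      \<Sum>k\<in>{0..m}. G i k * (of_bool (i = q i) - of_bool (k = q i))))"
  proof (intro sum.cong refl arg_cong2[where f = "(*)"] prod.cong)
    fix q i assume "q \<in> {q. q permutes {0..<m}}" "i \<in> {0..<m}"
    then show "?A $$ (i, q i) = (\<Sum>k\<in>{0..m}. G i k * (of_bool (i = q i) - of_bool (k = q i)))"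
      using permutes_in_image[of q "{0..<m}" i] by (intro entry) auto
  qed
  \<comment> \<open>Choosing one \<open>k\<close> per row amounts to choosing a map
    \<open>\<pi>\<close>. Exchanging the sums leaves the determinant of \<open>?I \<pi>\<close>,
    which only tests for cycles.\<close>
  also have "\<dots> = (\<Sum>q | q permutes {0..<m}. \<Sum>\<pi>\<in>?F. (\<Prod>i = 0..<m. G i (\<pi> i)) *
      (signof q * (\<Prod>i = 0..<m. (of_bool (i = q i) - of_bool (\<pi> i = q i)))))"
    by (subst prod_sum_PiE) (simp_all add: sum_distrib_left prod.distrib mult.left_commute)
  also have "\<dots> = (\<Sum>\<pi>\<in>?F. (\<Prod>i = 0..<m. G i (\<pi> i)) * Determinant.det (?I \<pi>))"
  proof (subst sum.swap, rule sum.cong[OF refl])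
    fix \<pi>
    have "Determinant.det (?I \<pi>) = (\<Sum>q | q permutes {0..<m}. signof q * (\<Prod>i = 0..<m. (?I \<pi>) $$ (i, q i)))"
      by (rule det_def') auto
    also have "\<dots> = (\<Sum>q | q permutes {0..<m}. signof q * (\<Prod>i = 0..<m. (of_bool (i = q i) - of_bool (\<pi> i = q i))))"
    proof (intro sum.cong refl arg_cong2[where f = "(*)"] prod.cong)
      fix q i assume "q \<in> {q. q permutes {0..<m}}" "i \<in> {0..<m}"
      then show "?I \<pi> $$ (i, q i) = of_bool (i = q i) - of_bool (\<pi> i = q i)"
        using permutes_in_image[of q "{0..<m}" i] by auto
    qed
    finally show "(\<Sum>q | q permutes {0..<m}. (\<Prod>i = 0..<m. G i (\<pi> i)) *
      (signof q * (\<Prod>i = 0..<m. (of_bool (i = q i) - of_bool (\<pi> i = q i))))) = (\<Prod>i = 0..<m. G i (\<pi> i)) * Determinant.det (?I \<pi>)"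
      by (simp only: sum_distrib_left)
  qed
  also have "\<dots> = (\<Sum>\<pi>\<in>?F. if ranked_on {0..<m} \<pi> then \<Prod>i = 0..<m. G i (\<pi> i) else 0)"
    by (intro sum.cong refl) (simp add: det_id_minus_ranked det_id_minus_unranked)
  also have "\<dots> = (\<Sum>\<pi> | \<pi> \<in> ?F \<and> ranked_on {0..<m} \<pi>. \<Prod>i\<in>{0..<m}. G i (\<pi> i))"
    by (subst sum.inter_filter[symmetric]) (auto intro!: finite_PiE)
  finally show ?thesis .
qed

text \<open>Replacing row \<open>i\<close> by \<open>e\<^sub>i - e\<^sub>j\<close> keeps all row sums zero, so the cofactors \<open>(i, i)\<close> and
  \<open>(i, j)\<close> agree; symmetry does the rest.\<close>

lemma cofactor_diag_eq:
  fixes L :: "real mat"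
  assumes L: "L \<in> carrier_mat n n" and sym: "transpose_mat L = L"
    and row: "\<And>i. i < n \<Longrightarrow> (\<Sum>j<n. L $$ (i, j)) = 0"
    and i: "i < n" and j: "j < n"
  shows "Determinant.det (mat_delete L i i) = Determinant.det (mat_delete L j j)"
proof -
  have eq: "cofactor L i i = cofactor L i j" if i: "i < n" and j: "j < n" for i j
  proof (cases "i = j")
    case False
    let ?N = "Matrix.mat n n (\<lambda>(a, b). if a = i then (if b = i then 1 else if b = j then -1 else 0) else L $$ (a, b))"
    have N: "?N \<in> carrier_mat n n" by simp
    have del: "mat_delete ?N i b = mat_delete L i b" if "b < n" for b
      using L i that by (intro eq_matI) (auto simp: mat_delete_def)
    have "?N *\<^sub>v Matrix.vec n (\<lambda>_. 1) = 0\<^sub>v n"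
    proof (rule eq_vecI)
      fix a assume "a < dim_vec (0\<^sub>v n :: real vec)"
      then have a: "a < n" by simp
      have "(?N *\<^sub>v Matrix.vec n (\<lambda>_. 1)) $ a = (\<Sum>b<n. ?N $$ (a, b))"
        using a by (auto simp: scalar_prod_def lessThan_atLeast0 intro!: sum.cong)
      also have "\<dots> = 0"
      proof (cases "a = i")
        case True
        have "(\<Sum>b<n. ?N $$ (a, b)) = (\<Sum>b<n. (if b = i then 1 else 0) - (if b = j then 1 else 0))"
          using a True False by (intro sum.cong) auto
        then show ?thesis using i j by (simp add: sum_subtractf sum.delta)
      next
        case False
        then have "(\<Sum>b<n. ?N $$ (a, b)) = (\<Sum>b<n. L $$ (a, b))" using a by (intro sum.cong) auto
        then show ?thesis using row[OF a] by simp
      qed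
      finally show "(?N *\<^sub>v Matrix.vec n (\<lambda>_. 1)) $ a = 0\<^sub>v n $ a" using a by simp
    qed simp
    moreover have "Matrix.vec n (\<lambda>_. 1) \<noteq> (0\<^sub>v n :: real vec)" 
    proof
      assume "Matrix.vec n (\<lambda>_. 1) = (0\<^sub>v n :: real vec)"
      then have "Matrix.vec n (\<lambda>_. 1) $ i = (0\<^sub>v n :: real vec) $ i" by simp
      then show False using i by simp
    qed
    ultimately have "Determinant.det ?N = 0"
      by (subst det_0_iff_vec_prod_zero[OF N]) (auto intro!: exI[of _ "Matrix.vec n (\<lambda>_. 1)"])
    moreover have "Determinant.det ?N = (\<Sum>b<n. ?N $$ (i, b) * cofactor ?N i b)"
      by (rule laplace_expansion_row[OF N i])
    \<comment> \<open>Cofactors along row \<open>i\<close> do not see row \<open>i\<close>, so those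
      of \<open>?N\<close> are those of \<open>L\<close>.\<close>
    moreover have "\<dots> = (\<Sum>b<n. (if b = i then cofactor L i i else 0) - (if b = j then cofactor L i j else 0))"
      using i False by (intro sum.cong) (auto simp: cofactor_def del)
    ultimately show ?thesis using i j by (simp add: sum_subtractf sum.delta)
  qed simp
  have tr: "cofactor L i j = cofactor L j i"
  proof -
    have "transpose_mat (mat_delete L i j) = mat_delete (transpose_mat L) j i"
      using L i j by (intro eq_matI) (auto simp: mat_delete_def)
    then have "Determinant.det (mat_delete L j i) = Determinant.det (transpose_mat (mat_delete L i j))"
      using sym by simp
    also have "\<dots> = Determinant.det (mat_delete L i j)"
      using L by (intro det_transpose[of _ "n - 1"]) auto
    finally show ?thesis by (simp add: cofactor_def add.commute)
  qed
  have "cofactor L i i = cofactor L j j" using eq[OF i j] tr eq[OF j i] by simp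
  then show ?thesis by (simp add: cofactor_def)
qed

text \<open>For \<open>I \<subseteq> J\<close> these are the forests on \<open>J\<close> with root
  set \<open>J - I\<close>, every other vertex storing its parent. Extensionality makes each forest
  a single function, so that sums over forests count it once.\<close>

definition parent_maps :: "'a set \<Rightarrow> 'a set \<Rightarrow> ('a \<Rightarrow> 'a) set" where
  "parent_maps I J = {\<pi> \<in> I \<rightarrow>\<^sub>E J. ranked_on I \<pi>}"

lemma finite_parent_maps: "finite I \<Longrightarrow> finite J \<Longrightarrow> finite (parent_maps I J)"
  by (rule finite_subset[of _ "I \<rightarrow>\<^sub>E J"]) (auto simp: parent_maps_def intro: finite_PiE)

lemma ranked_on_conjugate:
  assumes e: "bij_betw e J J'" and I: "I \<subseteq> J" and \<pi>: "ranked_on I \<pi>" and \<pi>': "\<And>i. i \<in> I \<Longrightarrow> \<pi>' (e i) = e (\<pi> i)"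
    and ran: "\<And>i. i \<in> I \<Longrightarrow> \<pi> i \<in> J"
  shows "ranked_on (e ` I) \<pi>'"
proof -
  obtain h :: "'a \<Rightarrow> nat" where h: "\<And>i. i \<in> I \<Longrightarrow> \<pi> i \<in> I \<Longrightarrow> h (\<pi> i) < h i"
    using \<pi> unfolding ranked_on_def by metis
  have inj: "inj_on e J" using e by (simp add: bij_betw_def)
  have inv: "inv_into J e (e i) = i" if "i \<in> J" for i using inj that by simp
  show ?thesis unfolding ranked_on_def
  proof (intro exI[of _ "\<lambda>x. h (inv_into J e x)"] ballI impI)
    fix x assume "x \<in> e ` I" "\<pi>' x \<in> e ` I"
    then obtain i where i: "i \<in> I" "x = e i" "e (\<pi> i) \<in> e ` I" using \<pi>' by auto
    then have "\<pi> i \<in> I" using inj I ran[OF i(1)] by (auto simp: inj_on_def subset_iff)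
    then show "h (inv_into J e (\<pi>' x)) < h (inv_into J e x)"
      using i h \<pi>' inv I ran by auto
  qed
qed

text \<open>Conjugation by \<open>e\<close> matches the two sets of forests. It carries the
  determinant expansion from matrix indices to the vertices of a block.\<close>

lemma sum_parent_maps_reindex:
  fixes f :: "'b \<Rightarrow> 'b \<Rightarrow> real"
  assumes e: "bij_betw e J J'" and I: "I \<subseteq> J"
  shows "(\<Sum>\<pi>\<in>parent_maps I J. \<Prod>i\<in>I. f (e i) (e (\<pi> i))) = (\<Sum>\<pi>\<in>parent_maps (e ` I) J'. \<Prod>x\<in>e ` I. f x (\<pi> x))"
proof -
  let ?r = "inv_into J e"
  have inj: "inj_on e J" and img: "e ` J = J'" using e by (auto simp: bij_betw_def)
  have injI: "inj_on e I" using inj I by (rule inj_on_subset)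
  have r: "?r (e i) = i" if "i \<in> J" for i using inj that by simp
  have er: "e (?r x) = x" if "x \<in> J'" for x using img that by (simp add: f_inv_into_f)
  have rJ: "?r x \<in> J" if "x \<in> J'" for x using img that by (auto simp: inv_into_into)
  have re: "bij_betw ?r J' J" using e by (rule bij_betw_inv_into)
  have rI: "?r ` (e ` I) = I" using r I by force
  let ?i = "\<lambda>\<pi>. \<lambda>i\<in>I. ?r (\<pi> (e i))" and ?j = "\<lambda>\<pi>. \<lambda>x\<in>e ` I. e (\<pi> (?r x))"
  show ?thesis
  proof (rule sum.reindex_bij_witness[where i = ?i and j = ?j])
    fix \<pi> assume \<pi>: "\<pi> \<in> parent_maps I J"
    then have p1: "\<pi> \<in> I \<rightarrow>\<^sub>E J" and p2: "ranked_on I \<pi>" by (auto simp: parent_maps_def)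
    have p3: "\<pi> i \<in> J" if "i \<in> I" for i using p1 that by auto
    show "?i (?j \<pi>) = \<pi>"
    proof
      fix i show "?i (?j \<pi>) i = \<pi> i" using r I p1 p3 by (cases "i \<in> I") (auto simp: subset_iff)
    qed
    have "?j \<pi> \<in> e ` I \<rightarrow>\<^sub>E J'" using p3 r I img by (auto simp: subset_iff)
    moreover have "ranked_on (e ` I) (?j \<pi>)"
      using I r p3 by (intro ranked_on_conjugate[OF e I p2]) (auto simp: subset_iff)
    ultimately show "?j \<pi> \<in> parent_maps (e ` I) J'" by (simp add: parent_maps_def)
    show "(\<Prod>x\<in>e ` I. f x (?j \<pi> x)) = (\<Prod>i\<in>I. f (e i) (e (\<pi> i)))"
      using r I by (subst prod.reindex[OF injI]) (auto intro!: prod.cong simp: subset_iff)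
  next
    fix \<pi> assume \<pi>: "\<pi> \<in> parent_maps (e ` I) J'"
    then have p1: "\<pi> \<in> e ` I \<rightarrow>\<^sub>E J'" and p2: "ranked_on (e ` I) \<pi>" by (auto simp: parent_maps_def)
    have p3: "\<pi> (e i) \<in> J'" if "i \<in> I" for i using p1 that by auto
    show "?j (?i \<pi>) = \<pi>"
    proof
      fix x show "?j (?i \<pi>) x = \<pi> x"
      proof (cases "x \<in> e ` I")
        case True
        then obtain i where i: "i \<in> I" "x = e i" by blast
        then have "?r x = i" using r I by blast
        then show ?thesis using i er[OF p3[OF i(1)]] by simp
      next
        case False
        then show ?thesis using PiE_arb[OF p1] by simp
      qed
    qed
    have "?i \<pi> \<in> I \<rightarrow>\<^sub>E J" using p3 rJ by auto
    moreover have "ranked_on (?r ` (e ` I)) (?i \<pi>)"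
    proof (rule ranked_on_conjugate[OF re _ p2])
      show "e ` I \<subseteq> J'" using I img by blast
      fix x assume "x \<in> e ` I"
      then obtain i where i: "i \<in> I" "x = e i" by blast
      then have "?r x = i" using r I by blast
      then show "(?i \<pi>) (?r x) = ?r (\<pi> x)" using i by simp
      show "\<pi> x \<in> J'" using i p3 by simp
    qed
    ultimately show "?i \<pi> \<in> parent_maps I J" by (simp add: parent_maps_def rI)
  qed
qed

text \<open>The enumeration lists the deleted vertex last: \<open>e m\<close> has no row of its own
  and so becomes the root of every tree.\<close>

lemma det_restricted_laplacian:
  fixes f :: "nat \<Rightarrow> nat \<Rightarrow> real"
  assumes e: "bij_betw e {0..m} V"
  shows "Determinant.det (Matrix.mat m m (\<lambda>(i, j). if i = j then \<Sum>t\<in>V - {e i}. f (e i) t else - f (e i) (e j))) =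
    (\<Sum>\<pi>\<in>parent_maps (V - {e m}) V. \<Prod>i\<in>V - {e m}. f i (\<pi> i))"
proof -
  have inj: "inj_on e {0..m}" and img: "e ` {0..m} = V" using e by (auto simp: bij_betw_def)
  have im: "e ` {0..<m} = V - {e m}"
  proof -
    have "e ` ({0..m} - {m}) = e ` {0..m} - e ` {m}"
      using inj by (intro inj_on_image_set_diff) auto
    moreover have "{0..m} - {m} = {0..<m}" by auto
    ultimately show ?thesis by (simp add: img)
  qed
  have diag: "(\<Sum>t\<in>V - {e i}. f (e i) t) = (\<Sum>k\<in>{0..m} - {i}. f (e i) (e k))" if "i < m" for i
  proof -
    have "e ` ({0..m} - {i}) = V - {e i}"
      using inj_on_image_set_diff[OF inj, of "{0..m}" "{i}"] that img by auto
    moreover have "inj_on e ({0..m} - {i})" using inj by (rule inj_on_subset) auto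
    ultimately show ?thesis
      using sum.reindex[of e "{0..m} - {i}" "f (e i)"] by (simp add: comp_def)
  qed
  have "Matrix.mat m m (\<lambda>(i, j). if i = j then \<Sum>t\<in>V - {e i}. f (e i) t else - f (e i) (e j)) =
    Matrix.mat m m (\<lambda>(i, j). if i = j then \<Sum>k\<in>{0..m} - {i}. f (e i) (e k) else - f (e i) (e j))"
    by (rule eq_matI) (auto simp: diag)
  moreover have subI: "{0..<m} \<subseteq> {0..m}" by auto
  ultimately show ?thesis
    using det_forest_expansion[of m "\<lambda>i j. f (e i) (e j)"]
      sum_parent_maps_reindex[OF e, of "{0..<m}" f, OF subI]
    unfolding im parent_maps_def by simp
qed

text \<open>All diagonal cofactors of a Laplacian agree, so the vertex deleted in the definition can
  be traded for any \<open>a\<close>. This freedom is what allows the root weights to be summed over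
  every possible root.\<close>

lemma laplacian_minor_eq_trees:
  fixes f :: "nat \<Rightarrow> nat \<Rightarrow> real"
  assumes V: "finite V" and a: "a \<in> V" and sym: "\<And>s t. f s t = f t s"
  shows "laplacian_minor f V = (\<Sum>\<pi>\<in>parent_maps (V - {a}) V. \<Prod>i\<in>V - {a}. f i (\<pi> i))"
proof -
  define vs where "vs = sorted_list_of_set V"
  have vs: "distinct vs" "set vs = V" "length vs = card V" using V by (auto simp: vs_def)
  have n0: "0 < card V" using V a by (auto simp: card_gt_0_iff)
  let ?n = "card V"
  let ?L = "laplacian f V"
  have L: "?L = Matrix.mat ?n ?n (\<lambda>(i, j). if i = j then \<Sum>t\<in>V - {vs ! i}. f (vs ! i) t else - f (vs ! i) (vs ! j))"
    unfolding laplacian_def vs_def Let_def ..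
  have bij: "bij_betw ((!) vs) {..<?n} V" using vs by (metis bij_betw_nth)
  obtain b where b: "b < ?n" "vs ! b = a" using a vs by (metis in_set_conv_nth)
  have "laplacian_minor f V = Determinant.det (mat_delete ?L b b)"
    unfolding laplacian_minor_def
  proof (rule cofactor_diag_eq[of _ ?n])
    show "transpose_mat ?L = ?L" unfolding L by (rule eq_matI) (auto simp: sym)
    fix i assume i: "i < ?n"
    have "(\<Sum>j<?n. ?L $$ (i, j)) = ?L $$ (i, i) + (\<Sum>j\<in>{..<?n} - {i}. ?L $$ (i, j))"
      using i by (intro sum.remove) auto
    also have "(\<Sum>j\<in>{..<?n} - {i}. ?L $$ (i, j)) = (\<Sum>j\<in>{..<?n} - {i}. - f (vs ! i) (vs ! j))"
      using i by (intro sum.cong) (auto simp: L)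
    also have "\<dots> = (\<Sum>t\<in>V - {vs ! i}. - f (vs ! i) t)"
    proof (rule sum.reindex_bij_betw)
      show "bij_betw ((!) vs) ({..<?n} - {i}) (V - {vs ! i})"
        using bij i by (intro bij_betw_DiffI) (auto simp: bij_betw_def)
    qed
    finally show "(\<Sum>j<?n. ?L $$ (i, j)) = 0" using i by (simp add: L sum_negf)
  qed (use n0 b in \<open>auto simp: L\<close>)
  also obtain m where m: "?n = Suc m" using n0 not0_implies_Suc by blast
  \<comment> \<open>Lists the vertices other than \<open>a\<close> in the order of the matrix with
    row \<open>b\<close> removed, and puts \<open>a\<close> last, as
    \<open>det_restricted_laplacian\<close> expects.\<close>
  define e where "e i = (if i < m then vs ! (insert_index b i) else a)" for i
  have ii: "insert_index b i < ?n" if "i < m" for i using that m by (auto simp: insert_index_def)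
  have e: "bij_betw e {0..m} V"
  proof -
    have "bij_betw (insert_index b) {0..<m} ({0..<Suc m} - {b})"
      using insert_index_image[of b m] insert_index_inj_on b m by (auto simp: bij_betw_def)
    moreover have "bij_betw ((!) vs) ({0..<Suc m} - {b}) (V - {a})"
      using bij b m by (intro bij_betw_DiffI) (auto simp: bij_betw_def lessThan_atLeast0)
    ultimately have "bij_betw ((!) vs \<circ> insert_index b) {0..<m} (V - {a})" by (rule bij_betw_trans)
    then have "bij_betw e {0..<m} (V - {a})"
      by (subst bij_betw_cong[where g = "(!) vs \<circ> insert_index b"]) (auto simp: e_def)
    moreover have "bij_betw e {m} {a}" by (auto simp: e_def bij_betw_def)
    ultimately have "bij_betw e ({0..<m} \<union> {m}) ((V - {a}) \<union> {a})" by (rule bij_betw_combine) auto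
    moreover have "{0..<m} \<union> {m} = {0..m}" "(V - {a}) \<union> {a} = V" using a by auto
    ultimately show ?thesis by simp
  qed
  have "mat_delete ?L b b = Matrix.mat m m (\<lambda>(i, j). if i = j then \<Sum>t\<in>V - {e i}. f (e i) t else - f (e i) (e j))"
    using m ii by (intro eq_matI)
      (auto simp: mat_delete_def L e_def insert_index_def[symmetric] dest: inj_onD[OF insert_index_inj_on[of b UNIV]])
  also have "Determinant.det \<dots> = (\<Sum>\<pi>\<in>parent_maps (V - {e m}) V. \<Prod>i\<in>V - {e m}. f i (\<pi> i))"
    by (rule det_restricted_laplacian[OF e])
  finally show ?thesis by (simp add: e_def)
qed

section \<open>Forests and partitions\<close>

text \<open>The value \<open>0\<close>, which is never a vertex, marks the root.\<close>

definition rooted_trees :: "nat set \<Rightarrow> (nat \<Rightarrow> nat) set" where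
  "rooted_trees V = {\<pi> \<in> parent_maps V (insert 0 V). \<exists>!i. i \<in> V \<and> \<pi> i = 0}"

lemma finite_rooted_trees: "finite V \<Longrightarrow> finite (rooted_trees V)"
  by (simp add: rooted_trees_def finite_parent_maps)

text \<open>A rooted tree is a root together with a tree directed towards it. With the root weights
  stored in column 0 of \<open>g\<close>, its weight is one product over all vertices in which the
  root is no exception; the later comparison of forests works factor by factor on this form.\<close>

lemma weighted_matrix_tree:
  fixes g :: "nat \<Rightarrow> nat \<Rightarrow> real"
  assumes V: "finite V" and V0: "0 \<notin> V"
    and f: "\<And>s t. f s t = f t s" and g: "\<And>s t. s \<in> V \<Longrightarrow> t \<in> V \<Longrightarrow> g s t = f s t"
  shows "(\<Sum>a\<in>V. g a 0) * laplacian_minor f V = (\<Sum>\<pi>\<in>rooted_trees V. \<Prod>i\<in>V. g i (\<pi> i))"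
proof -
  let ?S = "SIGMA a:V. parent_maps (V - {a}) V"
  let ?w = "\<lambda>(a, \<pi>). g a 0 * (\<Prod>i\<in>V - {a}. g i (\<pi> i))"
  let ?j = "\<lambda>(a, \<pi>). \<pi>(a := 0)" and ?i = "\<lambda>\<rho>. let a = THE a. a \<in> V \<and> \<rho> a = 0 in (a, restrict \<rho> (V - {a}))"
  have "(\<Sum>a\<in>V. g a 0) * laplacian_minor f V = (\<Sum>a\<in>V. g a 0 * (\<Sum>\<pi>\<in>parent_maps (V - {a}) V. \<Prod>i\<in>V - {a}. f i (\<pi> i)))"
    unfolding sum_distrib_right by (intro sum.cong refl) (simp add: laplacian_minor_eq_trees[of V _ f] V f)
  also have "\<dots> = (\<Sum>a\<in>V. \<Sum>\<pi>\<in>parent_maps (V - {a}) V. g a 0 * (\<Prod>i\<in>V - {a}. g i (\<pi> i)))"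
    unfolding sum_distrib_left
  proof (intro sum.cong refl arg_cong2[where f = "(*)"] prod.cong)
    fix a \<pi> i assume "\<pi> \<in> parent_maps (V - {a}) V" "i \<in> V - {a}"
    then show "f i (\<pi> i) = g i (\<pi> i)" by (subst g) (auto simp: parent_maps_def)
  qed
  also have "\<dots> = (\<Sum>x\<in>?S. ?w x)"
    using V by (subst sum.Sigma) (auto intro!: finite_parent_maps)
  also have "\<dots> = (\<Sum>\<pi>\<in>rooted_trees V. \<Prod>i\<in>V. g i (\<pi> i))"
  proof (rule sum.reindex_bij_witness[where i = ?i and j = ?j])
    fix x assume "x \<in> ?S"
    then obtain a \<pi> where x: "x = (a, \<pi>)" and a: "a \<in> V" and p1: "\<pi> \<in> (V - {a}) \<rightarrow>\<^sub>E V"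
      and p2: "ranked_on (V - {a}) \<pi>" by (auto simp: parent_maps_def)
    have pV: "\<pi> i \<in> V" "\<pi> i \<noteq> 0" if "i \<in> V" "i \<noteq> a" for i
    proof -
      show "\<pi> i \<in> V" using p1 that by blast
      then show "\<pi> i \<noteq> 0" using V0 by metis
    qed
    have root: "i \<in> V \<and> (\<pi>(a := 0)) i = 0 \<longleftrightarrow> i = a" for i
      using a pV by auto
    have the: "(THE i. i \<in> V \<and> (\<pi>(a := 0)) i = 0) = a" unfolding root by simp
    have "restrict (\<pi>(a := 0)) (V - {a}) = \<pi>"
    proof
      fix i show "restrict (\<pi>(a := 0)) (V - {a}) i = \<pi> i"
        using PiE_arb[OF p1, of i] by (cases "i \<in> V - {a}") auto
    qed
    then show "?i (?j x) = x" unfolding x by (simp only: the Let_def prod.case)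
    obtain h :: "nat \<Rightarrow> nat" where h: "\<And>i. i \<in> V - {a} \<Longrightarrow> \<pi> i \<in> V - {a} \<Longrightarrow> h (\<pi> i) < h i"
      using p2 unfolding ranked_on_def by metis
    have "ranked_on V (\<pi>(a := 0))" unfolding ranked_on_def
    \<comment> \<open>The rank on \<open>V - {a}\<close> says nothing about edges into
      \<open>a\<close>; shifting it up frees the value 0 for \<open>a\<close>.\<close>
    proof (intro exI[of _ "\<lambda>i. if i = a then 0 else Suc (h i)"] ballI impI)
      fix i assume i: "i \<in> V" "(\<pi>(a := 0)) i \<in> V"
      then have "i \<noteq> a" using V0 by auto
      then show "(if (\<pi>(a := 0)) i = a then 0 else Suc (h ((\<pi>(a := 0)) i))) < (if i = a then 0 else Suc (h i))"
        using i h[of i] by auto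
    qed
    moreover have "\<pi>(a := 0) \<in> V \<rightarrow>\<^sub>E insert 0 V"
    proof (rule PiE_I)
      fix i assume "i \<in> V" then show "(\<pi>(a := 0)) i \<in> insert 0 V" using pV[of i] by (cases "i = a") auto
    next
      fix i assume "i \<notin> V" then show "(\<pi>(a := 0)) i = undefined" using a PiE_arb[OF p1, of i] by (cases "i = a") auto
    qed
    moreover have "\<exists>!i. i \<in> V \<and> (\<pi>(a := 0)) i = 0" unfolding root by simp
    ultimately have "\<pi>(a := 0) \<in> rooted_trees V" unfolding rooted_trees_def parent_maps_def by blast
    then show "?j x \<in> rooted_trees V" by (simp add: x)
    have "(\<Prod>i\<in>V. g i ((\<pi>(a := 0)) i)) = g a 0 * (\<Prod>i\<in>V - {a}. g i ((\<pi>(a := 0)) i))"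
      using V a by (subst prod.remove[of _ a]) auto
    also have "(\<Prod>i\<in>V - {a}. g i ((\<pi>(a := 0)) i)) = (\<Prod>i\<in>V - {a}. g i (\<pi> i))"
      by (intro prod.cong) auto
    finally show "(\<Prod>i\<in>V. g i (?j x i)) = ?w x" by (simp add: x)
  next
    fix \<rho> assume \<rho>: "\<rho> \<in> rooted_trees V"
    then have r1: "\<rho> \<in> V \<rightarrow>\<^sub>E insert 0 V" and r2: "ranked_on V \<rho>" and r3: "\<exists>!i. i \<in> V \<and> \<rho> i = 0"
      by (auto simp: rooted_trees_def parent_maps_def)
    define a where "a = (THE i. i \<in> V \<and> \<rho> i = 0)"
    have a: "a \<in> V" "\<rho> a = 0" using theI'[OF r3] by (auto simp: a_def)
    have na: "\<rho> i \<in> V" if "i \<in> V" "i \<noteq> a" for i using r1 r3 a that by blast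
    have i\<rho>: "?i \<rho> = (a, restrict \<rho> (V - {a}))" by (simp add: a_def Let_def)
    have "restrict \<rho> (V - {a}) \<in> (V - {a}) \<rightarrow>\<^sub>E V" using na by auto
    moreover have "ranked_on (V - {a}) (restrict \<rho> (V - {a}))"
      using r2 unfolding ranked_on_def by (metis Diff_iff restrict_apply')
    ultimately show "?i \<rho> \<in> ?S" unfolding i\<rho> using a by (simp add: parent_maps_def)
    have "(restrict \<rho> (V - {a}))(a := 0) = \<rho>"
    proof
      fix i show "((restrict \<rho> (V - {a}))(a := 0)) i = \<rho> i"
        using a PiE_arb[OF r1, of i] by (cases "i \<in> V") auto
    qed
    then show "?j (?i \<rho>) = \<rho>" unfolding i\<rho> by simp
  qed
  finally show ?thesis .
qed

section \<open>Forests that respect a partition\<close>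

definition block_of :: "'a set set \<Rightarrow> 'a \<Rightarrow> 'a set" where
  "block_of P i = (THE V. V \<in> P \<and> i \<in> V)"

lemma block_of_eq:
  assumes "partition_on A P" "V \<in> P" "i \<in> V"
  shows "block_of P i = V"
  unfolding block_of_def
proof (rule the_equality)
  fix W assume "W \<in> P \<and> i \<in> W"
  then show "W = V" using assms partition_onD2[OF assms(1)] by (auto simp: disjoint_def)
qed (use assms in auto)

lemma block_of:
  assumes "partition_on A P" "i \<in> A"
  shows "block_of P i \<in> P" "i \<in> block_of P i"
proof -
  obtain V where "V \<in> P" "i \<in> V" using assms partition_onD1 by fastforce
  then show "block_of P i \<in> P" "i \<in> block_of P i" using block_of_eq[OF assms(1)] by auto
qed

text \<open>As parent maps are acyclic, a block that no edge leaves and that has one root carries a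
  single spanning tree.\<close>

definition partition_forests :: "nat set \<Rightarrow> nat set set \<Rightarrow> (nat \<Rightarrow> nat) set" where
  "partition_forests A P = {F \<in> parent_maps A (insert 0 A).
     \<forall>V\<in>P. (\<forall>i\<in>V. F i \<in> insert 0 V) \<and> (\<exists>!i. i \<in> V \<and> F i = 0)}"

lemma finite_partition_forests: "finite A \<Longrightarrow> finite (partition_forests A P)"
  by (simp add: partition_forests_def finite_parent_maps)

text \<open>Distributing the product picks one tree for each block. Gluing the trees along
  \<open>block_of\<close> gives a forest, and restricting a forest to the blocks undoes
  this.\<close>

lemma prod_rooted_trees:
  fixes g :: "nat \<Rightarrow> nat \<Rightarrow> real"
  assumes A: "finite A" "0 \<notin> A" and P: "partition_on A P"
  shows "(\<Prod>V\<in>P. \<Sum>\<pi>\<in>rooted_trees V. \<Prod>i\<in>V. g i (\<pi> i)) =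
    (\<Sum>F\<in>partition_forests A P. \<Prod>i\<in>A. g i (F i))"
proof -
  have finP: "finite P" using A P finite_elements by blast
  have sub: "V \<subseteq> A" if "V \<in> P" for V using P that partition_onD1 by blast
  have finV: "finite V" if "V \<in> P" for V using sub[OF that] A finite_subset by blast
  have V0: "0 \<notin> V" if "V \<in> P" for V using sub[OF that] A by blast
  note blk = block_of[OF P] and blk_eq = block_of_eq[OF P]
  have prodA: "(\<Prod>i\<in>A. q i) = (\<Prod>V\<in>P. \<Prod>i\<in>V. q i)" for q :: "nat \<Rightarrow> real"
    using prod.Union_disjoint[of P q] finV partition_onD2[OF P] partition_onD1[OF P]
    by (auto simp: disjoint_def)
  let ?j = "\<lambda>\<Phi>. \<lambda>i\<in>A. \<Phi> (block_of P i) i" and ?i = "\<lambda>F. \<lambda>V\<in>P. restrict F V"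
  have "(\<Prod>V\<in>P. \<Sum>\<pi>\<in>rooted_trees V. \<Prod>i\<in>V. g i (\<pi> i)) =
      (\<Sum>\<Phi>\<in>Pi\<^sub>E P rooted_trees. \<Prod>V\<in>P. \<Prod>i\<in>V. g i (\<Phi> V i))"
    by (intro prod_sum_PiE finP finite_rooted_trees finV)
  also have "\<dots> = (\<Sum>F\<in>partition_forests A P. \<Prod>i\<in>A. g i (F i))"
  proof (rule sum.reindex_bij_witness[where i = ?i and j = ?j])
    fix \<Phi> assume \<Phi>: "\<Phi> \<in> Pi\<^sub>E P rooted_trees"
    have t: "\<Phi> V \<in> rooted_trees V" if "V \<in> P" for V using \<Phi> that by blast
    have t1: "\<Phi> V \<in> V \<rightarrow>\<^sub>E insert 0 V" if "V \<in> P" for V using t[OF that] by (auto simp: rooted_trees_def parent_maps_def)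
    have t2: "ranked_on V (\<Phi> V)" if "V \<in> P" for V using t[OF that] by (auto simp: rooted_trees_def parent_maps_def)
    have t3: "\<exists>!i. i \<in> V \<and> \<Phi> V i = 0" if "V \<in> P" for V using t[OF that] by (auto simp: rooted_trees_def)
    have val: "?j \<Phi> i = \<Phi> V i" if "V \<in> P" "i \<in> V" for V i
      using that sub blk_eq[OF that] by auto
    have rst: "restrict (?j \<Phi>) V = \<Phi> V" if "V \<in> P" for V
    proof
      fix i show "restrict (?j \<Phi>) V i = \<Phi> V i"
        using val[OF that, of i] PiE_arb[OF t1[OF that], of i] by (cases "i \<in> V") auto
    qed
    show "?i (?j \<Phi>) = \<Phi>"
    proof
      fix V show "?i (?j \<Phi>) V = \<Phi> V" 
        using rst[of V] PiE_arb[OF \<Phi>, of V] by (cases "V \<in> P") auto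
    qed
    from t2 have "\<forall>V\<in>P. \<exists>h :: nat \<Rightarrow> nat. \<forall>i\<in>V. \<Phi> V i \<in> V \<longrightarrow> h (\<Phi> V i) < h i"
      unfolding ranked_on_def by simp
    then obtain h :: "nat set \<Rightarrow> nat \<Rightarrow> nat" where h: "\<And>V i. V \<in> P \<Longrightarrow> i \<in> V \<Longrightarrow> \<Phi> V i \<in> V \<Longrightarrow> h V (\<Phi> V i) < h V i"
      by metis
    have mem: "\<Phi> V i \<in> insert 0 V" if "V \<in> P" "i \<in> V" for V i using t1[OF that(1)] that by blast
    have "ranked_on A (?j \<Phi>)" unfolding ranked_on_def
    \<comment> \<open>Edges stay inside blocks, so the ranks of different blocks never have to be
      compared.\<close>
    proof (intro exI[of _ "\<lambda>i. h (block_of P i) i"] ballI impI)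
      fix i assume i: "i \<in> A" "?j \<Phi> i \<in> A"
      let ?V = "block_of P i"
      have V: "?V \<in> P" "i \<in> ?V" using blk[OF i(1)] by auto
      have "\<Phi> ?V i \<in> ?V" using i mem[OF V] A by auto
      then show "h (block_of P (?j \<Phi> i)) (?j \<Phi> i) < h ?V i"
        unfolding val[OF V] using blk_eq[OF V(1), of "\<Phi> ?V i"] h[OF V] by simp
    qed
    moreover have "?j \<Phi> \<in> A \<rightarrow>\<^sub>E insert 0 A"
    proof (rule PiE_I)
      fix i assume i: "i \<in> A"
      then show "?j \<Phi> i \<in> insert 0 A" using mem[OF blk[OF i]] sub[OF blk(1)[OF i]] by auto
    qed auto
    moreover have "(\<forall>i\<in>V. ?j \<Phi> i \<in> insert 0 V) \<and> (\<exists>!i. i \<in> V \<and> ?j \<Phi> i = 0)" if V: "V \<in> P" for V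
    proof
      have eq: "(i \<in> V \<and> ?j \<Phi> i = 0) = (i \<in> V \<and> \<Phi> V i = 0)" for i
        by (rule conj_cong[OF refl]) (simp only: val[OF V])
      show "\<exists>!i. i \<in> V \<and> ?j \<Phi> i = 0" unfolding eq by (rule t3[OF V])
      show "\<forall>i\<in>V. ?j \<Phi> i \<in> insert 0 V"
      proof
        fix i assume "i \<in> V"
        then show "?j \<Phi> i \<in> insert 0 V" unfolding val[OF V \<open>i \<in> V\<close>] by (rule mem[OF V])
      qed
    qed
    ultimately show "?j \<Phi> \<in> partition_forests A P"
      unfolding partition_forests_def parent_maps_def by blast
    have "(\<Prod>i\<in>A. g i (?j \<Phi> i)) = (\<Prod>V\<in>P. \<Prod>i\<in>V. g i (?j \<Phi> i))" by (rule prodA)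
    also have "\<dots> = (\<Prod>V\<in>P. \<Prod>i\<in>V. g i (\<Phi> V i))" by (intro prod.cong refl) (simp only: val)
    finally show "(\<Prod>i\<in>A. g i (?j \<Phi> i)) = (\<Prod>V\<in>P. \<Prod>i\<in>V. g i (\<Phi> V i))" .
  next
    fix F assume F: "F \<in> partition_forests A P"
    then have F1: "F \<in> A \<rightarrow>\<^sub>E insert 0 A" and F2: "ranked_on A F"
      and F3: "\<And>V i. V \<in> P \<Longrightarrow> i \<in> V \<Longrightarrow> F i \<in> insert 0 V" and F4: "\<And>V. V \<in> P \<Longrightarrow> \<exists>!i. i \<in> V \<and> F i = 0"
      by (auto simp: partition_forests_def parent_maps_def)
    show "?j (?i F) = F"
    proof
      fix i show "?j (?i F) i = F i" using blk[of i] PiE_arb[OF F1, of i] by (cases "i \<in> A") auto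
    qed
    show "?i F \<in> Pi\<^sub>E P rooted_trees"
    proof (rule PiE_I)
      fix V assume V: "V \<in> P"
      have "restrict F V \<in> V \<rightarrow>\<^sub>E insert 0 V" using F3[OF V] by auto
      moreover have "ranked_on V (restrict F V)"
        using F2 sub[OF V] unfolding ranked_on_def by (metis restrict_apply' subsetD)
      moreover have "\<exists>!i. i \<in> V \<and> restrict F V i = 0" using F4[OF V] by (metis restrict_apply')
      ultimately show "?i F V \<in> rooted_trees V" using V by (simp add: rooted_trees_def parent_maps_def)
    qed auto
  qed
  finally show ?thesis .
qed

text \<open>A forest determines its partition. From a vertex common to a block of \<open>P\<close>
  and a block of \<open>Q\<close>, the path of parents stays in both until it ends, so the two
  blocks share their root; since every vertex of a block leads to that root, the blocks
  coincide.\<close>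

lemma partition_forests_subset:
  assumes P: "partition_on A P" and Q: "partition_on A Q" and A0: "0 \<notin> A"
    and FP: "F \<in> partition_forests A P" and FQ: "F \<in> partition_forests A Q"
  shows "P \<subseteq> Q"
proof -
  obtain h :: "nat \<Rightarrow> nat" where h: "\<And>i. i \<in> A \<Longrightarrow> F i \<in> A \<Longrightarrow> h (F i) < h i"
    using FP unfolding partition_forests_def parent_maps_def ranked_on_def by blast
  have root_in: "r \<in> W"
    if R: "partition_on A R" "partition_on A R'" "F \<in> partition_forests A R" "F \<in> partition_forests A R'"
      and V: "V \<in> R" and W: "W \<in> R'" and r: "r \<in> V" "F r = 0" and i: "i \<in> V" "i \<in> W" for R R' V W r i
    using i
  proof (induction "h i" arbitrary: i rule: less_induct)
    case less
    have iA: "i \<in> A" using less.prems V R partition_onD1 by blast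
    show ?case
    proof (cases "F i = 0")
      case True
      then have "i = r" using R V r less.prems unfolding partition_forests_def by blast
      then show ?thesis using less.prems by simp
    next
      case False
      have "F i \<in> insert 0 V" using R(3) V less.prems(1) unfolding partition_forests_def by blast
      moreover have "F i \<in> insert 0 W" using R(4) W less.prems(2) unfolding partition_forests_def by blast
      ultimately have F: "F i \<in> V" "F i \<in> W" using False by auto
      then have "F i \<in> A" using V R partition_onD1 by blast
      then show ?thesis using less.hyps h[OF iA] F by blast
    qed
  qed
  have sub: "V \<subseteq> W"
    if R: "partition_on A R" "partition_on A R'" "F \<in> partition_forests A R" "F \<in> partition_forests A R'"
      and V: "V \<in> R" and W: "W \<in> R'" and i: "i \<in> V" "i \<in> W" for R R' V W i
  proof
    fix j assume j: "j \<in> V"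
    obtain r where r: "r \<in> V" "F r = 0" using R V unfolding partition_forests_def by blast
    have "j \<in> A" using j V R partition_onD1 by blast
    then obtain W' where W': "W' \<in> R'" "j \<in> W'" using R partition_onD1 by blast
    have "r \<in> W" "r \<in> W'" using root_in[OF R V W r i] root_in[OF R V W'(1) r j W'(2)] by auto
    then have "W = W'" using W W' R partition_onD2 by (metis disjoint_def disjoint_iff)
    then show "j \<in> W" using W' by simp
  qed
  show ?thesis
  proof
    fix V assume V: "V \<in> P"
    then obtain i where i: "i \<in> V" using P partition_onD3 by (metis all_not_in_conv)
    then have "i \<in> A" using V P partition_onD1 by blast
    then obtain W where W: "W \<in> Q" "i \<in> W" using Q partition_onD1 by blast
    have "V = W" using sub[OF P Q FP FQ V W(1) i W(2)] sub[OF Q P FQ FP W(1) V W(2) i] by blast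
    then show "V \<in> Q" using W by simp
  qed
qed

text \<open>Lets the factorial of the number of blocks be read off the forest, so that a sum over
  partitions and their forests becomes a sum over forests alone.\<close>

lemma card_roots_partition_forest:
  assumes A: "finite A" and P: "partition_on A P" and F: "F \<in> partition_forests A P"
  shows "card {i \<in> A. F i = 0} = card P"
proof -
  have eq: "{i \<in> A. F i = 0} = (\<Union>V\<in>P. {i \<in> V. F i = 0})" using partition_onD1[OF P] by auto
  have one: "\<exists>r. {i \<in> V. F i = 0} = {r}" if "V \<in> P" for V
  proof -
    have "\<exists>!i. i \<in> V \<and> F i = 0" using F that unfolding partition_forests_def by blast
    then show ?thesis by blast
  qed
  have "card (\<Union>V\<in>P. {i \<in> V. F i = 0}) = (\<Sum>V\<in>P. card {i \<in> V. F i = 0})"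
  proof (rule card_UN_disjoint)
    show "finite P" using A P finite_elements by blast
    show "\<forall>V\<in>P. finite {i \<in> V. F i = 0}" using one by (metis finite.simps)
    show "\<forall>V\<in>P. \<forall>W\<in>P. V \<noteq> W \<longrightarrow> {i \<in> V. F i = 0} \<inter> {i \<in> W. F i = 0} = {}"
      using partition_onD2[OF P] by (auto simp: disjoint_def)
  qed
  also have "\<dots> = (\<Sum>V\<in>P. 1)" using one by (intro sum.cong refl) (metis card_1_singleton_iff One_nat_def)
  finally show ?thesis by (simp add: eq)
qed

section \<open>Comparing all forests with those of one partition\<close>

lemma fact_add_le_power: "b + d \<le> n \<Longrightarrow> fact (b + d) \<le> fact b * real n ^ d"
proof (induction d)
  case (Suc d)
  have "fact (b + Suc d) = real (b + Suc d) * fact (b + d)" by simp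
  also have "\<dots> \<le> real n * (fact b * real n ^ d)"
    using Suc by (intro mult_mono) auto
  finally show ?case by (simp add: algebra_simps)
qed simp

text \<open>The map \<open>\<phi>\<close> turns a forest \<open>F\<close> into one with a single tree per block of \<open>P\<close>: it cuts the edges
  that leave a block, then hangs the roots \<open>R F\<close> of each block below the smallest one, \<open>m F V\<close>.
  Given \<open>\<phi> F i = k\<close>, only the values \<open>S i k\<close> are possible for \<open>F i\<close>, so every fibre is dominated by
  a product over vertices.  The factor \<open>n\<close> in \<open>u\<close> pays for the quotient of the factorials, one for
  each surplus root.\<close>

lemma forest_sum_le:
  fixes g :: "nat \<Rightarrow> nat \<Rightarrow> real"
  assumes A: "finite A" "0 \<notin> A" and P: "partition_on A P"
    and g0: "\<And>i k. i \<in> A \<Longrightarrow> 0 \<le> g i k"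
    and cross: "\<And>i j. i \<in> A \<Longrightarrow> j \<in> A \<Longrightarrow> j \<notin> block_of P i \<Longrightarrow> g i j \<le> \<tau> * g i 0"
    and within: "\<And>i j. i \<in> A \<Longrightarrow> j \<in> block_of P i \<Longrightarrow> i \<noteq> j \<Longrightarrow> g i 0 \<le> \<eta> * g i j"
    and \<tau>: "0 \<le> \<tau>" and \<eta>: "0 \<le> \<eta>" and n: "n = card A"
  shows "(\<Sum>F\<in>parent_maps A (insert 0 A). fact (card {i \<in> A. F i = 0}) * (\<Prod>i\<in>A. g i (F i)))
    \<le> fact (card P) * (1 + n * \<tau> + n * \<eta> * (1 + \<tau>)) ^ n * (\<Sum>F\<in>partition_forests A P. \<Prod>i\<in>A. g i (F i))"
proof -
  note blk = block_of[OF P] and blk_eq = block_of_eq[OF P]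
  have blk_sub: "block_of P i \<subseteq> A" if "i \<in> A" for i using blk(1)[OF that] P partition_onD1 by blast
  have blk_fin: "finite (block_of P i)" if "i \<in> A" for i using blk_sub[OF that] A finite_subset by blast
  let ?M = "parent_maps A (insert 0 A)"
  \<comment> \<open>Contains the old roots too, because 0 lies in no block.\<close>
  define R where "R F = {i \<in> A. F i \<notin> block_of P i}" for F
  define m where "m F V = Min {i \<in> V. i \<in> R F}" for F :: "nat \<Rightarrow> nat" and V
  define \<phi> where "\<phi> F = (\<lambda>i\<in>A. if i \<in> R F then (if i = m F (block_of P i) then 0 else m F (block_of P i)) else F i)" for F
  define c where "c = 1 + n * \<tau> + n * \<eta> * (1 + \<tau>)"
  define u where "u i j k = g i j * (if j = 0 \<and> k \<noteq> 0 then real n else 1)" for i j k :: nat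
  define S where "S i k = (if k = 0 then insert 0 (A - block_of P i) else insert k (insert 0 (A - block_of P i)))" for i k :: nat
  have finS: "finite (S i k)" for i k using A by (auto simp: S_def)

  have m_in: "m F V \<in> V" "m F V \<in> R F" if F: "F \<in> ?M" and V: "V \<in> P" for F V
  proof -
    obtain h :: "nat \<Rightarrow> nat" where h: "\<And>i. i \<in> A \<Longrightarrow> F i \<in> A \<Longrightarrow> h (F i) < h i"
      using F unfolding parent_maps_def ranked_on_def by blast
    have VA: "V \<subseteq> A" using V P partition_onD1 by blast
    then have fV: "finite V" using A finite_subset by blast
    have "V \<noteq> {}" using V P partition_onD3 by blast
    \<comment> \<open>A vertex of least rank in \<open>V\<close> cannot have its parent in
      \<open>V\<close>, so each block meets \<open>R F\<close> and the minimum \<open>m F V\<close>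
      is taken over a nonempty set.\<close>
    then obtain i where i: "i \<in> V" "\<And>j. j \<in> V \<Longrightarrow> h i \<le> h j"
      using ex_min_if_finite[of "h ` V"] fV by (metis (no_types, lifting) arg_min_if_finite(1) arg_min_least)
    have "F i \<notin> V" using i h[of i] VA by (metis not_le subsetD)
    then have "i \<in> R F" using i VA blk_eq[OF V i(1)] by (auto simp: R_def)
    then have "Min {i \<in> V. i \<in> R F} \<in> {i \<in> V. i \<in> R F}" using i fV by (intro Min_in) auto
    then show "m F V \<in> V" "m F V \<in> R F" by (auto simp: m_def)
  qed
  have \<phi>_zero: "\<phi> F i = 0 \<longleftrightarrow> i = m F V" if F: "F \<in> ?M" and V: "V \<in> P" "i \<in> V" for F V i
  proof -
    have i: "i \<in> A" using V P partition_onD1 by blast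
    have b: "block_of P i = V" using blk_eq[OF V] .
    have "m F V \<in> A" using m_in(2)[OF F V(1)] by (simp add: R_def)
    then have "m F V \<noteq> 0" using A by metis
    moreover have "F i \<noteq> 0" if "i \<notin> R F"
    proof -
      have "F i \<in> A" using that i blk_sub[OF i] by (auto simp: R_def)
      then show ?thesis using A by metis
    qed
    ultimately show ?thesis using m_in(2)[OF F V(1)] i by (auto simp: \<phi>_def b)
  qed
  have \<phi>_mem: "\<phi> F \<in> partition_forests A P" if F: "F \<in> ?M" for F
  proof -
    obtain h :: "nat \<Rightarrow> nat" where h: "\<And>i. i \<in> A \<Longrightarrow> F i \<in> A \<Longrightarrow> h (F i) < h i"
      using F unfolding parent_maps_def ranked_on_def by blast
    have ins: "\<phi> F i \<in> insert 0 (block_of P i)" if i: "i \<in> A" for i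
      using m_in(1)[OF F blk(1)[OF i]] i by (auto simp: \<phi>_def R_def)
    have "ranked_on A (\<phi> F)" unfolding ranked_on_def
    \<comment> \<open>The chosen root gets rank 0 and everything else is lifted above it. Hanging
      the other members of \<open>R F\<close> below it is then harmless, whatever their old ranks
      were.\<close>
    proof (intro exI[of _ "\<lambda>i. if i = m F (block_of P i) then 0 else Suc (h i)"] ballI impI)
      fix i assume i: "i \<in> A" "\<phi> F i \<in> A"
      let ?V = "block_of P i" and ?h = "\<lambda>i. if i = m F (block_of P i) then 0 else Suc (h i)"
      have ne: "i \<noteq> m F ?V" using \<phi>_zero[OF F blk[OF i(1)]] i A by metis
      show "?h (\<phi> F i) < ?h i"
      proof (cases "i \<in> R F")
        case True
        then have "\<phi> F i = m F ?V" using i ne by (simp add: \<phi>_def)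
        moreover have "block_of P (m F ?V) = ?V"
          using blk_eq[OF blk(1)[OF i(1)] m_in(1)[OF F blk(1)[OF i(1)]]] .
        ultimately show ?thesis using ne by simp
      next
        case False
        then have "\<phi> F i = F i" using i by (simp add: \<phi>_def)
        then show ?thesis using ne h[OF i(1)] i by auto
      qed
    qed
    moreover have "\<phi> F \<in> A \<rightarrow>\<^sub>E insert 0 A"
    proof (rule PiE_I)
      fix i assume "i \<in> A" then show "\<phi> F i \<in> insert 0 A" using ins blk_sub by blast
    qed (simp add: \<phi>_def)
    moreover have "(\<forall>i\<in>V. \<phi> F i \<in> insert 0 V) \<and> (\<exists>!i. i \<in> V \<and> \<phi> F i = 0)" if V: "V \<in> P" for V
    proof
      show "\<forall>i\<in>V. \<phi> F i \<in> insert 0 V" using ins blk_eq[OF V] V P partition_onD1 by blast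
      show "\<exists>!i. i \<in> V \<and> \<phi> F i = 0" using \<phi>_zero[OF F V] m_in(1)[OF F V] by auto
    qed
    ultimately show ?thesis unfolding partition_forests_def parent_maps_def by blast
  qed
  have fibre: "F i \<in> S i (\<phi> F i)" if F: "F \<in> ?M" and i: "i \<in> A" for F i
  proof (cases "i \<in> R F")
    case True
    then have "F i \<in> insert 0 (A - block_of P i)" using F i unfolding parent_maps_def R_def by blast
    then show ?thesis by (auto simp: S_def)
  next
    case False
    then have "\<phi> F i = F i" using i by (simp add: \<phi>_def)
    then show ?thesis by (auto simp: S_def)
  qed
  have weight: "fact (card {i \<in> A. F i = 0}) * (\<Prod>i\<in>A. g i (F i)) \<le> fact (card P) * (\<Prod>i\<in>A. u i (F i) (\<phi> F i))"
    if F: "F \<in> ?M" for F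
  proof -
    define B where "B = {i \<in> A. F i = 0 \<and> \<phi> F i \<noteq> 0}"
    \<comment> \<open>Truncated subtraction: \<open>d\<close> is 0 when \<open>F\<close> has fewer
      roots than \<open>P\<close> has blocks. As \<open>\<phi> F\<close> has exactly
      \<open>card P\<close> roots, at least \<open>d\<close> roots of \<open>F\<close> cease to be
      roots, and these are among \<open>B\<close>.\<close>
    define d where "d = card {i \<in> A. F i = 0} - card P"
    have dn: "card {i \<in> A. F i = 0} \<le> n" unfolding n using A by (intro card_mono) auto
    have "card {i \<in> A. F i = 0} \<le> card ({i \<in> A. \<phi> F i = 0} \<union> B)"
      using A by (intro card_mono) (auto simp: B_def)
    also have "\<dots> \<le> card {i \<in> A. \<phi> F i = 0} + card B" by (rule card_Un_le)
    finally have dB: "d \<le> card B"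
      using card_roots_partition_forest[OF A(1) P \<phi>_mem[OF F]] by (simp add: d_def)
    have "fact (card {i \<in> A. F i = 0}) \<le> fact (card P) * real n ^ d"
    proof (cases "card P \<le> card {i \<in> A. F i = 0}")
      case True
      then show ?thesis using fact_add_le_power[of "card P" d n] dn by (simp add: d_def)
    next
      case False
      then show ?thesis by (auto simp: d_def intro: fact_mono)
    qed
    also have "\<dots> \<le> fact (card P) * real n ^ card B"
    proof (cases "d = 0")
      case True
      show ?thesis
      proof (cases "B = {}")
        case False
        then have "n \<noteq> 0" using A n by (auto simp: B_def)
        then show ?thesis using True by simp
      qed (use True in simp)
    next
      case False
      then have "1 \<le> n" using dn by (simp add: d_def)
      then show ?thesis using dB by (intro mult_left_mono power_increasing) auto
    qed
    finally have f: "fact (card {i \<in> A. F i = 0}) \<le> fact (card P) * real n ^ card B" .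
    have "(\<Prod>i\<in>A. u i (F i) (\<phi> F i)) = (\<Prod>i\<in>A. g i (F i)) * (\<Prod>i\<in>A. if F i = 0 \<and> \<phi> F i \<noteq> 0 then real n else 1)"
      by (simp add: u_def prod.distrib)
    also have "(\<Prod>i\<in>A. if F i = 0 \<and> \<phi> F i \<noteq> 0 then real n else 1) = real n ^ card B"
      using A by (subst prod.inter_filter[symmetric]) (simp_all add: B_def)
    finally have "(\<Prod>i\<in>A. u i (F i) (\<phi> F i)) = (\<Prod>i\<in>A. g i (F i)) * real n ^ card B" .
    moreover have "0 \<le> (\<Prod>i\<in>A. g i (F i))" using g0 by (intro prod_nonneg) auto
    ultimately show ?thesis using mult_right_mono[OF f, of "\<Prod>i\<in>A. g i (F i)"] by (simp add: mult_ac)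
  qed
  have unn: "0 \<le> u i j k" if "i \<in> A" for i j k using g0[OF that] by (simp add: u_def)
  \<comment> \<open>A root of \<open>T\<close> was a root or came from at most \<open>n\<close>
    crossing edges, at relative cost \<open>n * \<tau>\<close>. A non-root kept its parent, or was a
    surplus root, at cost \<open>n * \<eta>\<close>, or came from a crossing edge, at cost
    \<open>n * \<tau> * \<eta>\<close> by way of the root weight. The constant \<open>c\<close>
    covers both cases.\<close>
  have row: "(\<Sum>j\<in>S i (T i). u i j (T i)) \<le> c * g i (T i)"
    if T: "T \<in> partition_forests A P" and i: "i \<in> A" for T i
  proof -
    obtain h :: "nat \<Rightarrow> nat" where h: "\<And>i. i \<in> A \<Longrightarrow> T i \<in> A \<Longrightarrow> h (T i) < h i"
      using T unfolding partition_forests_def parent_maps_def ranked_on_def by blast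
    have mem: "T i \<in> insert 0 (block_of P i)" using T blk[OF i] unfolding partition_forests_def by blast
    let ?C = "A - block_of P i"
    have out: "(\<Sum>j\<in>?C. u i j k) \<le> n * \<tau> * g i 0" for k
    proof -
      have "(\<Sum>j\<in>?C. u i j k) \<le> (\<Sum>j\<in>?C. \<tau> * g i 0)"
        using cross[OF i] A by (intro sum_mono) (auto simp: u_def)
      also have "\<dots> = card ?C * (\<tau> * g i 0)" by simp
      also have "\<dots> \<le> n * (\<tau> * g i 0)"
        using \<tau> g0[OF i] A unfolding n by (intro mult_right_mono) (auto intro!: card_mono)
      finally show ?thesis by (simp add: mult.assoc)
    qed
    have C0: "0 \<notin> ?C" using A by auto
    show ?thesis
    proof (cases "T i = 0")
      case True
      have "(\<Sum>j\<in>S i (T i). u i j (T i)) = u i 0 0 + (\<Sum>j\<in>?C. u i j 0)"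
        using A C0 by (simp add: S_def True)
      also have "\<dots> \<le> g i 0 + n * \<tau> * g i 0" using out[of 0] by (simp add: u_def)
      also have "\<dots> \<le> c * g i 0" using \<tau> \<eta> g0[OF i] by (simp add: c_def algebra_simps)
      finally show ?thesis using True by simp
    next
      case False
      then have k: "T i \<in> block_of P i" using mem by simp
      then have kA: "T i \<in> A" using blk_sub[OF i] by blast
      then have ne: "T i \<noteq> i" using h[OF i] by force
      have "(\<Sum>j\<in>S i (T i). u i j (T i)) = u i (T i) (T i) + (u i 0 (T i) + (\<Sum>j\<in>?C. u i j (T i)))"
        using A C0 False k by (simp add: S_def)
      also have "\<dots> \<le> g i (T i) + (n * g i 0 + n * \<tau> * g i 0)" using out[of "T i"] False by (simp add: u_def)
      also have "\<dots> = g i (T i) + n * (1 + \<tau>) * g i 0" by (simp add: algebra_simps)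
      also have "\<dots> \<le> g i (T i) + n * (1 + \<tau>) * (\<eta> * g i (T i))"
        using within[OF i k] ne \<tau> by (intro add_left_mono mult_left_mono) auto
      also have "\<dots> \<le> c * g i (T i)" using \<tau> g0[OF i, of "T i"] by (simp add: c_def algebra_simps)
      finally show ?thesis .
    qed
  qed
  have finM: "finite ?M" using A by (simp add: finite_parent_maps)
  have finT: "finite (partition_forests A P)" using A by (simp add: finite_partition_forests)
  have "(\<Sum>F\<in>?M. fact (card {i \<in> A. F i = 0}) * (\<Prod>i\<in>A. g i (F i)))
      \<le> (\<Sum>F\<in>?M. fact (card P) * (\<Prod>i\<in>A. u i (F i) (\<phi> F i)))"
    by (intro sum_mono weight)
  also have "\<dots> = fact (card P) * (\<Sum>F\<in>?M. \<Prod>i\<in>A. u i (F i) (\<phi> F i))" by (simp add: sum_distrib_left)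
  also have "(\<Sum>F\<in>?M. \<Prod>i\<in>A. u i (F i) (\<phi> F i)) =
      (\<Sum>T\<in>partition_forests A P. \<Sum>F\<in>{F \<in> ?M. \<phi> F = T}. \<Prod>i\<in>A. u i (F i) (\<phi> F i))"
    by (rule sum.group[symmetric]) (use finM finT \<phi>_mem in auto)
  also have "\<dots> \<le> (\<Sum>T\<in>partition_forests A P. c ^ n * (\<Prod>i\<in>A. g i (T i)))"
  proof (rule sum_mono)
    fix T assume T: "T \<in> partition_forests A P"
    have "(\<Sum>F\<in>{F \<in> ?M. \<phi> F = T}. \<Prod>i\<in>A. u i (F i) (\<phi> F i)) = (\<Sum>F\<in>{F \<in> ?M. \<phi> F = T}. \<Prod>i\<in>A. u i (F i) (T i))"
      by (rule sum.cong) auto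
    \<comment> \<open>Forgetting acyclicity only adds nonnegative terms and makes the sum factor
      over the vertices.\<close>
    also have "\<dots> \<le> (\<Sum>F\<in>Pi\<^sub>E A (\<lambda>i. S i (T i)). \<Prod>i\<in>A. u i (F i) (T i))"
    proof (rule sum_mono2)
      show "finite (Pi\<^sub>E A (\<lambda>i. S i (T i)))" using A finS by (intro finite_PiE)
      show "{F \<in> ?M. \<phi> F = T} \<subseteq> Pi\<^sub>E A (\<lambda>i. S i (T i))"
      proof
        fix F assume F: "F \<in> {F \<in> ?M. \<phi> F = T}"
        then have "F \<in> A \<rightarrow>\<^sub>E insert 0 A" by (simp add: parent_maps_def)
        then show "F \<in> Pi\<^sub>E A (\<lambda>i. S i (T i))" using fibre[of F] F by (auto simp: PiE_iff)
      qed
      show "0 \<le> (\<Prod>i\<in>A. u i (F i) (T i))" for F using unn by (intro prod_nonneg) auto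
    qed
    also have "\<dots> = (\<Prod>i\<in>A. \<Sum>j\<in>S i (T i). u i j (T i))"
      by (rule prod_sum_PiE[symmetric]) (use A finS in auto)
    also have "\<dots> \<le> (\<Prod>i\<in>A. c * g i (T i))"
      using row[OF T] unn by (intro prod_mono) (auto intro!: sum_nonneg)
    also have "\<dots> = c ^ n * (\<Prod>i\<in>A. g i (T i))" by (simp add: prod.distrib n)
    finally show "(\<Sum>F\<in>{F \<in> ?M. \<phi> F = T}. \<Prod>i\<in>A. u i (F i) (\<phi> F i)) \<le> c ^ n * (\<Prod>i\<in>A. g i (T i))" .
  qed
  finally show ?thesis by (simp add: c_def sum_distrib_left mult.assoc mult_left_mono)
qed

section \<open>The posterior as a ratio of forest sums\<close>

lemma rooted_trees_nonempty:
  assumes "V \<noteq> {}" "0 \<notin> V"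
  shows "rooted_trees V \<noteq> {}"
proof -
  obtain a where a: "a \<in> V" using assms by blast
  then have a0: "a \<noteq> 0" using assms by metis
  let ?\<pi> = "\<lambda>i\<in>V. if i = a then 0 else a"
  have "ranked_on V ?\<pi>"
    unfolding ranked_on_def using assms a
    by (intro exI[of _ "\<lambda>i. if i = a then 0 else 1"]) auto
  moreover have "i \<in> V \<and> ?\<pi> i = 0 \<longleftrightarrow> i = a" for i using a a0 by auto
  ultimately have "?\<pi> \<in> rooted_trees V"
    using a by (auto simp: rooted_trees_def parent_maps_def)
  then show ?thesis by blast
qed

lemma edge_weight_sym: "edge_weight p \<sigma> y s t = edge_weight p \<sigma> y t s"
  by (simp add: edge_weight_def euclid_dist_def L2_set_def power2_commute)

lemma edge_weight_pos: "\<sigma> > 0 \<Longrightarrow> edge_weight p \<sigma> y s t > 0"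
  by (simp add: edge_weight_def)

lemma finite_ordered_partitions: "finite (ordered_partitions m)"
proof (rule finite_subset)
  show "ordered_partitions m \<subseteq> {Vs. set Vs \<subseteq> Pow {1..m} \<and> distinct Vs}"
    by (auto simp: ordered_partitions_def partition_on_def)
qed (rule finite_subset_distinct, simp)

context
  fixes n p :: nat and \<sigma> lam :: real and r :: "(nat \<Rightarrow> real) \<Rightarrow> real" and y :: "nat \<Rightarrow> nat \<Rightarrow> real"
  assumes \<sigma>: "\<sigma> > 0" and lam: "lam > 0" and r: "\<And>i. i \<in> {1..n} \<Longrightarrow> r (y i) > 0"
begin

private abbreviation g :: "nat \<Rightarrow> nat \<Rightarrow> real" where
  "g i k \<equiv> (if k = 0 then lam * r (y i) else edge_weight p \<sigma> y i k)"

private lemma g_pos: "i \<in> {1..n} \<Longrightarrow> g i k > 0"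
  using lam r \<sigma> by (simp add: edge_weight_pos)

lemma bsf_block_weight:
  assumes "V \<subseteq> {1..n}"
  shows "lam * (\<Sum>i\<in>V. r (y i)) * laplacian_minor (edge_weight p \<sigma> y) V = (\<Sum>\<pi>\<in>rooted_trees V. \<Prod>i\<in>V. g i (\<pi> i))"
proof -
  have "finite V" "0 \<notin> V" using assms finite_subset by auto
  moreover have "g s t = edge_weight p \<sigma> y s t" if "t \<in> V" for s t using that \<open>0 \<notin> V\<close> by auto
  ultimately show ?thesis
    using weighted_matrix_tree[of V "edge_weight p \<sigma> y" g, OF _ _ edge_weight_sym]
    by (simp add: sum_distrib_left)
qed

lemma bsf_weight_eq_forests:
  assumes Vs: "Vs \<in> ordered_partitions n"
  shows "bsf_weight p \<sigma> lam r y Vs = (\<Sum>F\<in>partition_forests {1..n} (set Vs). \<Prod>i\<in>{1..n}. g i (F i))"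
proof -
  have d: "distinct Vs" and P: "partition_on {1..n} (set Vs)" using Vs by (auto simp: ordered_partitions_def)
  have "bsf_weight p \<sigma> lam r y Vs = (\<Prod>V\<in>set Vs. lam * (\<Sum>i\<in>V. r (y i)) * laplacian_minor (edge_weight p \<sigma> y) V)"
    unfolding bsf_weight_def by (simp only: prod.distinct_set_conv_list[OF d])
  also have "\<dots> = (\<Prod>V\<in>set Vs. \<Sum>\<pi>\<in>rooted_trees V. \<Prod>i\<in>V. g i (\<pi> i))"
    using partition_onD1[OF P] by (intro prod.cong refl bsf_block_weight) auto
  also have "\<dots> = (\<Sum>F\<in>partition_forests {1..n} (set Vs). \<Prod>i\<in>{1..n}. g i (F i))"
    by (rule prod_rooted_trees) (use P in auto)
  finally show ?thesis .
qed

lemma bsf_weight_pos: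
  assumes Vs: "Vs \<in> ordered_partitions n"
  shows "bsf_weight p \<sigma> lam r y Vs > 0"
proof -
  have d: "distinct Vs" and P: "partition_on {1..n} (set Vs)" using Vs by (auto simp: ordered_partitions_def)
  have "0 < lam * (\<Sum>i\<in>V. r (y i)) * laplacian_minor (edge_weight p \<sigma> y) V" if V: "V \<in> set Vs" for V
  proof -
    have sub: "V \<subseteq> {1..n}" "V \<noteq> {}" using V partition_onD1[OF P] partition_onD3[OF P] by auto
    have "finite V" "0 \<notin> V" using sub finite_subset by auto
    then have "0 < (\<Sum>\<pi>\<in>rooted_trees V. \<Prod>i\<in>V. g i (\<pi> i))"
      using g_pos sub by (intro sum_pos prod_pos finite_rooted_trees rooted_trees_nonempty) blast+
    then show ?thesis by (simp only: bsf_block_weight[OF sub(1)])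
  qed
  then have "0 < (\<Prod>V\<in>set Vs. lam * (\<Sum>i\<in>V. r (y i)) * laplacian_minor (edge_weight p \<sigma> y) V)"
    by (rule prod_pos)
  then show ?thesis unfolding bsf_weight_def by (simp only: prod.distinct_set_conv_list[OF d])
qed

text \<open>These trivial bounds take over on the bad event and whenever the bound of
  \<open>bsf_prob_not_equiv_le\<close> exceeds 1.\<close>

lemma bsf_prob_not_equiv_range:
  assumes Vs: "Vs \<in> ordered_partitions n"
  shows "0 \<le> bsf_prob_not_equiv n p \<sigma> lam r y Vs" "bsf_prob_not_equiv n p \<sigma> lam r y Vs \<le> 1"
proof -
  let ?w = "bsf_weight p \<sigma> lam r y"
  let ?Z = "\<Sum>Ws\<in>ordered_partitions n. ?w Ws"
  have Z: "0 < ?Z" using Vs by (intro sum_pos finite_ordered_partitions bsf_weight_pos) auto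
  have "bsf_prob_equiv n p \<sigma> lam r y Vs = (\<Sum>Ws | Ws \<in> ordered_partitions n \<and> set Ws = set Vs. ?w Ws / ?Z)"
    by (simp add: bsf_prob_equiv_eq_sum[OF Vs] bsf_posterior_def)
  also have "\<dots> \<le> (\<Sum>Ws\<in>ordered_partitions n. ?w Ws / ?Z)"
    using Z bsf_weight_pos by (intro sum_mono2 finite_ordered_partitions) (auto intro!: divide_nonneg_nonneg simp: less_imp_le)
  also have "\<dots> = 1" using Z by (simp flip: sum_divide_distrib)
  finally show "0 \<le> bsf_prob_not_equiv n p \<sigma> lam r y Vs" by (simp add: bsf_prob_not_equiv_def)
  show "bsf_prob_not_equiv n p \<sigma> lam r y Vs \<le> 1"
    using Z bsf_weight_pos[OF Vs] by (simp add: bsf_prob_not_equiv_def bsf_prob_equiv_def bsf_posterior_def)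
qed

text \<open>Grouping ordered partitions by their set of blocks gives each partition a factorial.
  Forests determine their partitions, so the normalizing constant is a sum over distinct forests and
  \<open>forest_sum_le\<close> bounds it by \<open>(1 + \<epsilon>) ^ n\<close> times the mass of
  the class of \<open>Vs\<close>. Its reciprocal is at least
  \<open>1 - n * \<epsilon>\<close>.\<close>

lemma bsf_prob_not_equiv_le:
  assumes Vs: "Vs \<in> ordered_partitions n"
    and cross: "\<And>i j V. i \<in> {1..n} \<Longrightarrow> j \<in> {1..n} \<Longrightarrow> (\<nexists>V. V \<in> set Vs \<and> i \<in> V \<and> j \<in> V) \<Longrightarrow>
      edge_weight p \<sigma> y i j \<le> \<tau> * (lam * r (y i))"
    and within: "\<And>i j V. V \<in> set Vs \<Longrightarrow> i \<in> V \<Longrightarrow> j \<in> V \<Longrightarrow> i \<noteq> j \<Longrightarrow>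
      lam * r (y i) \<le> \<eta> * edge_weight p \<sigma> y i j"
    and \<tau>: "0 \<le> \<tau>" and \<eta>: "0 \<le> \<eta>"
  shows "bsf_prob_not_equiv n p \<sigma> lam r y Vs \<le> real n * (real n * \<tau> + real n * \<eta> * (1 + \<tau>))"
proof -
  let ?A = "{1..n}"
  let ?w = "bsf_weight p \<sigma> lam r y"
  let ?Z = "\<Sum>Ws\<in>ordered_partitions n. ?w Ws"
  let ?Q = "{P. partition_on ?A P}"
  define W where "W P = (\<Sum>F\<in>partition_forests ?A P. \<Prod>i\<in>?A. g i (F i))" for P
  define \<epsilon> where "\<epsilon> = real n * \<tau> + real n * \<eta> * (1 + \<tau>)"
  have \<epsilon>: "0 \<le> \<epsilon>" using \<tau> \<eta> by (simp add: \<epsilon>_def)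
  have d: "distinct Vs" and P: "partition_on ?A (set Vs)" using Vs by (auto simp: ordered_partitions_def)
  have in_ordered: "partition_on ?A (set Ws)" if "Ws \<in> ordered_partitions n" for Ws
    using that by (simp add: ordered_partitions_def)
  have finQ: "finite ?Q" by (simp add: finitely_many_partition_on)
  have prod_nn: "0 \<le> (\<Prod>i\<in>?A. g i (F i))" for F using g_pos by (intro prod_nonneg ballI less_imp_le) blast
  have Z: "0 < ?Z" using Vs by (intro sum_pos finite_ordered_partitions bsf_weight_pos) auto
  have "?Z = (\<Sum>P\<in>?Q. \<Sum>Ws\<in>{Ws \<in> ordered_partitions n. set Ws = P}. ?w Ws)"
    by (rule sum.group[symmetric]) (use finQ finite_ordered_partitions in_ordered in blast)+
  also have "\<dots> = (\<Sum>P\<in>?Q. \<Sum>F\<in>partition_forests ?A P. fact (card {i \<in> ?A. F i = 0}) * (\<Prod>i\<in>?A. g i (F i)))"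
  proof (rule sum.cong[OF refl])
    fix P assume P: "P \<in> ?Q"
    have eq: "{Ws \<in> ordered_partitions n. set Ws = P} = permutations_of_set P"
      using P by (auto simp: ordered_partitions_def permutations_of_set_def)
    have "finite P" using P finite_elements[of ?A P] by auto
    have "(\<Sum>Ws\<in>{Ws \<in> ordered_partitions n. set Ws = P}. ?w Ws) = (\<Sum>Ws\<in>permutations_of_set P. W P)"
      unfolding eq
    proof (rule sum.cong[OF refl])
      fix Ws assume "Ws \<in> permutations_of_set P"
      then have "Ws \<in> ordered_partitions n" "set Ws = P" using eq by auto
      then show "?w Ws = W P" using bsf_weight_eq_forests[of Ws] unfolding W_def by blast
    qed
    also have "\<dots> = fact (card P) * W P" using \<open>finite P\<close> by simp
    also have "\<dots> = (\<Sum>F\<in>partition_forests ?A P. fact (card {i \<in> ?A. F i = 0}) * (\<Prod>i\<in>?A. g i (F i)))"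
      unfolding W_def sum_distrib_left
    proof (rule sum.cong[OF refl])
      fix F assume F: "F \<in> partition_forests ?A P"
      have "card {i \<in> ?A. F i = 0} = card P"
        by (rule card_roots_partition_forest[OF _ _ F]) (use P in auto)
      then show "fact (card P) * (\<Prod>i\<in>?A. g i (F i)) = fact (card {i \<in> ?A. F i = 0}) * (\<Prod>i\<in>?A. g i (F i))"
        by (simp only:)
    qed
    finally show "(\<Sum>Ws\<in>{Ws \<in> ordered_partitions n. set Ws = P}. ?w Ws) =
        (\<Sum>F\<in>partition_forests ?A P. fact (card {i \<in> ?A. F i = 0}) * (\<Prod>i\<in>?A. g i (F i)))" .
  qed
  also have "\<dots> = (\<Sum>F\<in>(\<Union>P\<in>?Q. partition_forests ?A P). fact (card {i \<in> ?A. F i = 0}) * (\<Prod>i\<in>?A. g i (F i)))"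
  proof (rule sum.UNION_disjoint[symmetric])
    show "\<forall>P\<in>?Q. \<forall>Q\<in>?Q. P \<noteq> Q \<longrightarrow> partition_forests ?A P \<inter> partition_forests ?A Q = {}"
    proof (intro ballI impI)
      fix P Q assume PQ: "P \<in> ?Q" "Q \<in> ?Q" "P \<noteq> Q"
      show "partition_forests ?A P \<inter> partition_forests ?A Q = {}"
      proof (rule ccontr)
        assume "partition_forests ?A P \<inter> partition_forests ?A Q \<noteq> {}"
        then obtain F where F: "F \<in> partition_forests ?A P" "F \<in> partition_forests ?A Q" by blast
        have part: "partition_on ?A P" "partition_on ?A Q" and z: "0 \<notin> ?A" using PQ by auto
        have "P \<subseteq> Q" by (rule partition_forests_subset[OF part z F])
        moreover have "Q \<subseteq> P" by (rule partition_forests_subset[OF part(2,1) z F(2,1)])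
        ultimately have "P = Q" by (rule subset_antisym)
        then show False using PQ by blast
      qed
    qed
  qed (use finQ in \<open>auto intro: finite_partition_forests\<close>)
  also have "\<dots> \<le> (\<Sum>F\<in>parent_maps ?A (insert 0 ?A). fact (card {i \<in> ?A. F i = 0}) * (\<Prod>i\<in>?A. g i (F i)))"
    using prod_nn by (intro sum_mono2 finite_parent_maps) (auto simp: partition_forests_def simp del: prod_pos)
  also have "\<dots> \<le> fact (card (set Vs)) * (1 + n * \<tau> + n * \<eta> * (1 + \<tau>)) ^ n * W (set Vs)"
    unfolding W_def
  proof (rule forest_sum_le[where \<tau> = \<tau> and \<eta> = \<eta>])
    fix i k assume "i \<in> ?A" then show "0 \<le> g i k" using g_pos[of i k] by linarith
  next
    fix i j assume ij: "i \<in> ?A" "j \<in> ?A" "j \<notin> block_of (set Vs) i"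
    then have "\<nexists>V. V \<in> set Vs \<and> i \<in> V \<and> j \<in> V" using block_of_eq[OF P] by blast
    then show "g i j \<le> \<tau> * g i 0" using cross[OF ij(1,2)] ij by auto
  next
    fix i j assume ij: "i \<in> ?A" "j \<in> block_of (set Vs) i" "i \<noteq> j"
    then have "j \<in> ?A" using block_of[OF P ij(1)] partition_onD1[OF P] by blast
    then show "g i 0 \<le> \<eta> * g i j" using within[OF block_of[OF P ij(1)] ij(2,3)] by auto
  qed (use P \<tau> \<eta> in auto)
  finally have Zle: "?Z \<le> (1 + \<epsilon>) ^ n * (fact (length Vs) * ?w Vs)"
    using bsf_weight_eq_forests[OF Vs] distinct_card[OF d] by (simp add: W_def \<epsilon>_def add.assoc mult_ac)
  have B: "1 - real n * \<epsilon> \<le> bsf_prob_equiv n p \<sigma> lam r y Vs"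
  proof (cases "real n * \<epsilon> \<le> 1")
    case True
    have "(1 - real n * \<epsilon>) * ?Z \<le> (1 - real n * \<epsilon>) * ((1 + \<epsilon>) ^ n * (fact (length Vs) * ?w Vs))"
      using Zle True by (intro mult_left_mono) auto
    also have "\<dots> = ((1 - real n * \<epsilon>) * (1 + \<epsilon>) ^ n) * (fact (length Vs) * ?w Vs)" by simp
    also have "\<dots> \<le> 1 * (fact (length Vs) * ?w Vs)"
    proof (rule mult_right_mono)
      \<comment> \<open>Both factors are bounded by exponentials, with opposite exponents.\<close>
      have "(1 - real n * \<epsilon>) * (1 + \<epsilon>) ^ n \<le> exp (- (real n * \<epsilon>)) * exp \<epsilon> ^ n"
        using \<epsilon> exp_ge_add_one_self[of "- (real n * \<epsilon>)"] exp_ge_add_one_self[of \<epsilon>] True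
        by (intro mult_mono power_mono) auto
      also have "\<dots> = 1" by (simp add: exp_of_nat_mult[symmetric] exp_add[symmetric])
      finally show "(1 - real n * \<epsilon>) * (1 + \<epsilon>) ^ n \<le> 1" .
    qed (use bsf_weight_pos[OF Vs] in auto)
    finally show ?thesis using Z by (simp add: bsf_prob_equiv_def bsf_posterior_def pos_le_divide_eq)
  next
    case False
    then show ?thesis using bsf_prob_not_equiv_range[OF Vs] by (simp add: bsf_prob_not_equiv_def)
  qed
  then show ?thesis by (simp add: bsf_prob_not_equiv_def \<epsilon>_def)
qed

end

section \<open>Gaussian tails\<close>

definition bform :: "nat \<Rightarrow> real mat \<Rightarrow> (nat \<Rightarrow> real) \<Rightarrow> (nat \<Rightarrow> real) \<Rightarrow> real" where
  "bform p S x z = (\<Sum>i<p. \<Sum>j<p. x i * S $$ (i, j) * z j)"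

lemma bform_add_left: "bform p S (\<lambda>i. x i + t * w i) z = bform p S x z + t * bform p S w z"
  by (simp add: bform_def algebra_simps sum.distrib sum_distrib_left)

lemma bform_add_right: "bform p S z (\<lambda>i. x i + t * w i) = bform p S z x + t * bform p S z w"
  by (simp add: bform_def algebra_simps sum.distrib sum_distrib_left)

lemma bform_scale: "bform p S (\<lambda>i. c * x i) (\<lambda>i. c * x i) = c\<^sup>2 * bform p S x x"
  by (simp add: bform_def sum_distrib_left power2_eq_square algebra_simps)

lemma bform_commute:
  assumes "\<And>i j. i < p \<Longrightarrow> j < p \<Longrightarrow> S $$ (i, j) = S $$ (j, i)"
  shows "bform p S x z = bform p S z x"
  unfolding bform_def
  by (subst sum.swap) (auto intro!: sum.cong simp: assms)

lemma bform_expand: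
  assumes "\<And>i j. i < p \<Longrightarrow> j < p \<Longrightarrow> S $$ (i, j) = S $$ (j, i)"
  shows "bform p S (\<lambda>i. x i + t * w i) (\<lambda>i. x i + t * w i) = bform p S x x + 2 * t * bform p S w x + t\<^sup>2 * bform p S w w"
  unfolding bform_add_left bform_add_right using bform_commute[of p S x w] assms
  by (simp add: algebra_simps power2_eq_square)

lemma scalar_prod_mult_mat_vec:
  assumes "S \<in> carrier_mat p p"
  shows "scalar_prod (Matrix.vec p x) (S *\<^sub>v Matrix.vec p z) = bform p S x z"
  using assms by (auto simp: scalar_prod_def bform_def sum_distrib_left mult.assoc lessThan_atLeast0 intro!: sum.cong)

lemma pos_def_mat_bform:
  assumes "pos_def_mat p S"
  shows "i < p \<Longrightarrow> j < p \<Longrightarrow> S $$ (i, j) = S $$ (j, i)"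
    and "0 \<le> bform p S x x" and "(\<exists>i<p. x i \<noteq> 0) \<Longrightarrow> 0 < bform p S x x"
proof -
  have S: "S \<in> carrier_mat p p" "transpose_mat S = S"
    and pos: "\<And>v. v \<in> carrier_vec p \<Longrightarrow> v \<noteq> 0\<^sub>v p \<Longrightarrow> scalar_prod v (S *\<^sub>v v) > 0"
    using assms by (auto simp: pos_def_mat_def)
  show "S $$ (i, j) = S $$ (j, i)" if "i < p" "j < p"
    using S that by (metis carrier_matD index_transpose_mat(1))
  show gt: "0 < bform p S x x" if "\<exists>i<p. x i \<noteq> 0"
  proof -
    from that obtain i where i: "i < p" "x i \<noteq> 0" by blast
    have "Matrix.vec p x \<noteq> 0\<^sub>v p"
    proof
      assume "Matrix.vec p x = 0\<^sub>v p"
      then have "Matrix.vec p x $ i = 0\<^sub>v p $ i" by simp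
      then show False using i by simp
    qed
    then show ?thesis using pos[of "Matrix.vec p x"] S by (simp add: scalar_prod_mult_mat_vec)
  qed
  show "0 \<le> bform p S x x"
  proof (cases "\<exists>i<p. x i \<noteq> 0")
    case True then show ?thesis using gt by simp
  next
    case False then show ?thesis by (simp add: bform_def)
  qed
qed

text \<open>The dimension is not a type, so compactness comes from the product topology: the cube
  \<open>[-1, 1]\<close> in the first \<open>p\<close> coordinates and 0 in the others is compact,
  and the unit sphere is closed. Zeroing the coordinates from \<open>p\<close> on brings any unit
  vector into their intersection, and scaling treats the rest.\<close>

lemma bform_maximizer:
  assumes p: "0 < p"
  obtains x where "(\<Sum>i<p. (x i)\<^sup>2) = 1" "\<And>v. bform p S v v \<le> bform p S x x * (\<Sum>i<p. (v i)\<^sup>2)"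
proof -
  let ?K = "PiE UNIV (\<lambda>i::nat. if i < p then {-1..1::real} else {0})"
  let ?T = "{x :: nat \<Rightarrow> real. (\<Sum>i<p. (x i)\<^sup>2) = 1}"
  have cont: "continuous_on UNIV (\<lambda>x :: nat \<Rightarrow> real. x i)" for i by (rule continuous_on_product_coordinates)
  have "compactin (product_topology (\<lambda>i::nat. euclidean :: real topology) UNIV) ?K"
    by (subst compactin_PiE) auto
  then have "compact ?K" by (simp add: euclidean_product_topology)
  moreover have "closed ?T"
    by (intro closed_Collect_eq continuous_on_sum continuous_on_power cont continuous_on_const)
  ultimately have cpt: "compact (?K \<inter> ?T)" by (rule compact_Int_closed)
  have norm_in: "(\<lambda>i. if i < p then w i else 0) \<in> ?K \<inter> ?T" if w: "(\<Sum>i<p. (w i)\<^sup>2) = 1" for w :: "nat \<Rightarrow> real"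
  proof -
    have "\<bar>w i\<bar> \<le> 1" if "i < p" for i
    proof -
      have "(w i)\<^sup>2 \<le> (\<Sum>i<p. (w i)\<^sup>2)" using that by (intro member_le_sum) auto
      then show ?thesis using w by (simp add: abs_square_le_1)
    qed
    then show ?thesis using w by (auto simp: abs_le_iff)
  qed
  have "(\<Sum>i<p. (if i = 0 then 1 else 0 :: real)\<^sup>2) = (\<Sum>i<p. (if i = 0 then 1 else 0 :: real))"
    by (rule sum.cong) auto
  also have "\<dots> = 1" using p by (simp add: sum.delta)
  finally have "(\<lambda>i. if i < p then if i = 0 then 1 else 0 else 0) \<in> ?K \<inter> ?T" by (rule norm_in)
  then have ne: "?K \<inter> ?T \<noteq> {}" by (intro notI) (simp only: empty_iff)
  have contQ: "continuous_on (?K \<inter> ?T) (\<lambda>x. bform p S x x)"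
    unfolding bform_def
    by (intro continuous_on_sum continuous_on_mult continuous_on_const continuous_on_subset[OF cont]) auto
  obtain x where x1: "x \<in> ?K \<inter> ?T" and x2: "\<forall>z\<in>?K \<inter> ?T. bform p S z z \<le> bform p S x x"
    using continuous_attains_sup[OF cpt ne contQ] by (elim bexE) (rule that)
  have "bform p S v v \<le> bform p S x x * (\<Sum>i<p. (v i)\<^sup>2)" for v
  proof (cases "(\<Sum>i<p. (v i)\<^sup>2) = 0")
    case True
    then have "v i = 0" if "i < p" for i using that by (simp add: sum_nonneg_eq_0_iff)
    then show ?thesis using True by (simp add: bform_def)
  next
    case False
    define c where "c = sqrt (\<Sum>i<p. (v i)\<^sup>2)"
    have c2: "c\<^sup>2 = (\<Sum>i<p. (v i)\<^sup>2)" by (simp add: c_def sum_nonneg)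
    have c: "c \<noteq> 0" using False by (simp add: c_def)
    let ?w = "\<lambda>i. if i < p then inverse c * v i else 0"
    have "(\<Sum>i<p. (inverse c * v i)\<^sup>2) = 1"
      using c by (simp add: power_mult_distrib sum_distrib_left[symmetric] c2[symmetric] power_inverse)
    then have "bform p S ?w ?w \<le> bform p S x x" by (intro bspec[OF x2] norm_in)
    also have "bform p S ?w ?w = bform p S (\<lambda>i. inverse c * v i) (\<lambda>i. inverse c * v i)"
      by (simp add: bform_def)
    also have "\<dots> = bform p S v v / c\<^sup>2" by (simp only: bform_scale) (simp add: power_inverse divide_inverse)
    finally show ?thesis using c by (simp add: c2[symmetric] divide_le_eq)
  qed
  moreover have "(\<Sum>i<p. (x i)\<^sup>2) = 1" using x1 by simp
  ultimately show ?thesis by (rule that[rotated])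
qed

text \<open>First-order condition at a maximum: the witness \<open>t\<close> is positive and so
  small that the quadratic term cannot offset the linear one.\<close>

lemma quadratic_le_0_imp:
  fixes a K :: real
  assumes "\<And>t. 2 * t * a + t\<^sup>2 * K \<le> 0"
  shows "a \<le> 0"
proof (rule ccontr)
  assume a: "\<not> a \<le> 0"
  define t where "t = a / (\<bar>K\<bar> + 1)"
  have t: "0 < t" using a by (auto simp: t_def intro: divide_pos_pos)
  have "t * (2 * a + t * K) \<le> 0" using assms[of t] by (simp add: algebra_simps power2_eq_square)
  then have "2 * a + t * K \<le> 0" using t by (simp add: mult_le_0_iff)
  moreover have "t * \<bar>K\<bar> \<le> a" using a by (simp add: t_def field_simps)
  moreover have "- (t * \<bar>K\<bar>) \<le> t * K" using t by (simp add: abs_if)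
  ultimately show False using a by linarith
qed

text \<open>Rayleigh's principle. At a maximizer \<open>x\<close> of the form on the sphere, with
  value \<open>M\<close>, perturb in the direction \<open>w = S x - M x\<close>. The linear
  coefficient is twice the squared length of \<open>w\<close>, so the first-order condition forces
  \<open>w = 0\<close>. Thus \<open>M\<close> is an eigenvalue, and it is positive as a value of the
  form.\<close>

lemma max_eigenvalue_bound:
  assumes p: "0 < p" and pd: "pos_def_mat p S"
  shows "0 < max_eigenvalue S" and "bform p S v v \<le> max_eigenvalue S * (\<Sum>i<p. (v i)\<^sup>2)"
proof -
  have S: "S \<in> carrier_mat p p" using pd by (simp add: pos_def_mat_def)
  note sym = pos_def_mat_bform(1)[OF pd]
  obtain x where x1: "(\<Sum>i<p. (x i)\<^sup>2) = 1" and x: "\<And>v. bform p S v v \<le> bform p S x x * (\<Sum>i<p. (v i)\<^sup>2)"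
    using bform_maximizer[OF p, of S] by blast
  define M where "M = bform p S x x"
  define w where "w i = (\<Sum>j<p. S $$ (i, j) * x j) - M * x i" for i
  have "\<exists>i<p. x i \<noteq> 0"
  proof (rule ccontr)
    assume "\<not> ?thesis" then have "(\<Sum>i<p. (x i)\<^sup>2) = 0" by simp
    then show False using x1 by simp
  qed
  then have M: "0 < M" and xi: "\<exists>i<p. x i \<noteq> 0" using pos_def_mat_bform(3)[OF pd] by (auto simp: M_def)
  have bw: "bform p S w x - M * (\<Sum>i<p. w i * x i) = (\<Sum>i<p. (w i)\<^sup>2)"
  proof -
    define s where "s i = (\<Sum>j<p. S $$ (i, j) * x j)" for i
    have ws: "w i = s i - M * x i" for i by (simp add: w_def s_def)
    have "bform p S w x = (\<Sum>i<p. w i * s i)"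
      by (simp add: bform_def s_def sum_distrib_left mult.assoc)
    moreover have "(\<Sum>i<p. (w i)\<^sup>2) = (\<Sum>i<p. w i * s i - M * (w i * x i))"
      by (intro sum.cong refl) (simp add: power2_eq_square right_diff_distrib ws)
    ultimately show ?thesis by (simp add: sum_subtractf sum_distrib_left)
  qed
  have "(\<Sum>i<p. (w i)\<^sup>2) \<le> 0"
  proof (rule quadratic_le_0_imp)
    fix t
    have nx: "(\<Sum>i<p. (x i + t * w i)\<^sup>2) = 1 + 2 * t * (\<Sum>i<p. w i * x i) + t\<^sup>2 * (\<Sum>i<p. (w i)\<^sup>2)"
      unfolding x1[symmetric] sum_distrib_left sum.distrib[symmetric]
      by (intro sum.cong) (auto simp: power2_eq_square algebra_simps)
    have "bform p S (\<lambda>i. x i + t * w i) (\<lambda>i. x i + t * w i) \<le> M * (\<Sum>i<p. (x i + t * w i)\<^sup>2)"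
      unfolding M_def by (rule x)
    then have "M + 2 * t * bform p S w x + t\<^sup>2 * bform p S w w \<le> M * (1 + 2 * t * (\<Sum>i<p. w i * x i) + t\<^sup>2 * (\<Sum>i<p. (w i)\<^sup>2))"
      using bform_expand[of p S x t w] sym by (simp add: nx M_def)
    then show "2 * t * (\<Sum>i<p. (w i)\<^sup>2) + t\<^sup>2 * (bform p S w w - M * (\<Sum>i<p. (w i)\<^sup>2)) \<le> 0"
      unfolding bw[symmetric] by (simp add: algebra_simps)
  qed
  then have "(\<Sum>i<p. (w i)\<^sup>2) = 0" by (intro antisym sum_nonneg) auto
  then have w0: "w i = 0" if "i < p" for i using that by (simp add: sum_nonneg_eq_0_iff)
  have "eigenvector S (Matrix.vec p x) M" unfolding eigenvector_def
  proof (intro conjI)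
    show "Matrix.vec p x \<noteq> 0\<^sub>v (dim_row S)"
    proof
      assume eq: "Matrix.vec p x = 0\<^sub>v (dim_row S)"
      obtain i where i: "i < p" "x i \<noteq> 0" using xi by blast
      have "Matrix.vec p x $ i = 0\<^sub>v (dim_row S) $ i" using eq by simp
      then show False using i S by simp
    qed
    show "S *\<^sub>v Matrix.vec p x = M \<cdot>\<^sub>v Matrix.vec p x"
    proof (rule eq_vecI)
      fix i assume "i < dim_vec (M \<cdot>\<^sub>v Matrix.vec p x)"
      then have i: "i < p" by simp
      then show "(S *\<^sub>v Matrix.vec p x) $ i = (M \<cdot>\<^sub>v Matrix.vec p x) $ i"
        using S w0[OF i] by (simp add: w_def scalar_prod_def lessThan_atLeast0)
    qed (use S in auto)
  qed (use S in auto)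
  then have "M \<in> spectrum S" by (auto simp: spectrum_def eigenvalue_def)
  then have Mle: "M \<le> max_eigenvalue S"
    unfolding max_eigenvalue_def using card_finite_spectrum[OF S] by (intro Max_ge)
  then show "0 < max_eigenvalue S" using M by simp
  have "bform p S v v \<le> M * (\<Sum>i<p. (v i)\<^sup>2)" unfolding M_def by (rule x)
  also have "\<dots> \<le> max_eigenvalue S * (\<Sum>i<p. (v i)\<^sup>2)" using Mle by (intro mult_right_mono sum_nonneg) auto
  finally show "bform p S v v \<le> max_eigenvalue S * (\<Sum>i<p. (v i)\<^sup>2)" .
qed

text \<open>Positive definiteness leaves no kernel, so the \<open>the\<close> in
  \<open>mvn_density\<close> is applied to a genuine inverse.\<close>

lemma pos_def_mat_inverse:
  assumes pd: "pos_def_mat p S"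
  shows "the (mat_inverse S) \<in> carrier_mat p p" "S * the (mat_inverse S) = 1\<^sub>m p"
proof -
  have S: "S \<in> carrier_mat p p" using pd by (simp add: pos_def_mat_def)
  have "Determinant.det S \<noteq> 0"
  proof
    assume "Determinant.det S = 0"
    then obtain v where v: "v \<in> carrier_vec p" "v \<noteq> 0\<^sub>v p" "S *\<^sub>v v = 0\<^sub>v p"
      using det_0_iff_vec_prod_zero[OF S] by blast
    then have "scalar_prod v (S *\<^sub>v v) = 0" by simp
    then show False using pd v by (auto simp: pos_def_mat_def)
  qed
  then have "S \<in> Units (ring_mat TYPE(real) p ())" by (rule det_non_zero_imp_unit[OF S])
  then obtain B where "mat_inverse S = Some B" using mat_inverse(1)[OF S] by fastforce
  then show "the (mat_inverse S) \<in> carrier_mat p p" "S * the (mat_inverse S) = 1\<^sub>m p"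
    using mat_inverse(2)[OF S] by auto
qed

text \<open>Positivity of \<open>S\<close> at \<open>d - L v\<close>, where \<open>v\<close> is the inverse of \<open>S\<close> applied to \<open>d\<close>.\<close>

lemma inverse_bform_lower:
  assumes p: "0 < p" and pd: "pos_def_mat p S"
  shows "(\<Sum>i<p. (d i)\<^sup>2) \<le> max_eigenvalue S * bform p (the (mat_inverse S)) d d"
proof -
  let ?L = "max_eigenvalue S"
  let ?A = "the (mat_inverse S)"
  have S: "S \<in> carrier_mat p p" using pd by (simp add: pos_def_mat_def)
  note A = pos_def_mat_inverse[OF pd] and sym = pos_def_mat_bform(1)[OF pd]
  define v where "v i = (\<Sum>j<p. ?A $$ (i, j) * d j)" for i
  have "S *\<^sub>v (?A *\<^sub>v Matrix.vec p d) = Matrix.vec p d"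
    using A S by (simp add: assoc_mult_mat_vec[symmetric, of S p p ?A p])
  moreover have Av: "?A *\<^sub>v Matrix.vec p d = Matrix.vec p v"
    using A by (intro eq_vecI) (auto simp: v_def scalar_prod_def lessThan_atLeast0)
  ultimately have Sv: "S *\<^sub>v Matrix.vec p v = Matrix.vec p d" by simp
  have dv: "bform p S z v = (\<Sum>i<p. z i * d i)" for z
  proof -
    have "bform p S z v = scalar_prod (Matrix.vec p z) (Matrix.vec p d)"
      using scalar_prod_mult_mat_vec[OF S, of z v] by (simp add: Sv)
    then show ?thesis by (simp add: scalar_prod_def lessThan_atLeast0)
  qed
  have Adv: "bform p ?A d d = (\<Sum>i<p. v i * d i)"
    using scalar_prod_mult_mat_vec[OF A(1), of d d] Av
    by (simp add: scalar_prod_def lessThan_atLeast0 mult.commute)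
  have L: "0 < ?L" by (rule max_eigenvalue_bound[OF p pd])
  have "0 \<le> bform p S (\<lambda>i. d i + (- ?L) * v i) (\<lambda>i. d i + (- ?L) * v i)" by (rule pos_def_mat_bform(2)[OF pd])
  also have "\<dots> = bform p S d d - 2 * ?L * bform p S v d + ?L\<^sup>2 * bform p S v v"
    by (subst bform_expand) (use sym in auto)
  also have "bform p S v d = bform p S d v" using bform_commute sym by blast
  \<comment> \<open>Only the first term is estimated, by the largest eigenvalue; the other two are
    exact because \<open>S\<close> maps \<open>v\<close> to \<open>d\<close>.\<close>
  also have "bform p S d d - 2 * ?L * bform p S d v + ?L\<^sup>2 * bform p S v v
      \<le> ?L * (\<Sum>i<p. (d i)\<^sup>2) - 2 * ?L * (\<Sum>i<p. (d i)\<^sup>2) + ?L\<^sup>2 * bform p ?A d d"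
    using max_eigenvalue_bound(2)[OF p pd, of d] by (simp add: dv Adv power2_eq_square)
  finally have "?L * (\<Sum>i<p. (d i)\<^sup>2) \<le> ?L * (?L * bform p ?A d d)" by (simp add: power2_eq_square algebra_simps)
  then show ?thesis using L by simp
qed

text \<open>Fubini isolates one coordinate at a time, and the one-dimensional affine substitution
  contributes a factor \<open>c\<close> for each.\<close>

lemma nn_integral_PiM_lborel_affine:
  fixes c :: real
  assumes I: "finite I" and c: "0 < c" and f: "f \<in> borel_measurable (Pi\<^sub>M I (\<lambda>_. lborel))"
  shows "(\<integral>\<^sup>+x. f x \<partial>Pi\<^sub>M I (\<lambda>_. lborel)) =
    ennreal (c ^ card I) * (\<integral>\<^sup>+x. f (\<lambda>j\<in>I. t j + c * x j) \<partial>Pi\<^sub>M I (\<lambda>_. lborel))"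
  using I f
proof (induction I arbitrary: f rule: finite_induct)
  case empty
  then show ?case by (simp add: PiM_empty nn_integral_count_space_finite)
next
  case (insert i I)
  interpret product_sigma_finite "\<lambda>_::'a. lborel :: real measure" ..
  let ?N = "Pi\<^sub>M I (\<lambda>_. lborel :: real measure)" and ?N' = "Pi\<^sub>M (insert i I) (\<lambda>_. lborel :: real measure)"
  note [measurable] = insert.prems
  define G where "G x = (\<integral>\<^sup>+y. f (x(i := t i + c * y)) \<partial>lborel)" for x
  have m2: "(\<lambda>(x, y). x(i := t i + c * y)) \<in> ?N \<Otimes>\<^sub>M lborel \<rightarrow>\<^sub>M ?N'"
    unfolding split_beta by (rule measurable_fun_upd[where J = I]) auto
  have G[measurable]: "G \<in> borel_measurable ?N"
    unfolding G_def using measurable_compose[OF m2 insert.prems]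
    by (intro lborel.borel_measurable_nn_integral) (simp add: split_beta')
  have T[measurable]: "(\<lambda>x. \<lambda>j\<in>insert i I. t j + c * x j) \<in> ?N' \<rightarrow>\<^sub>M ?N'"
    by (rule measurable_restrict) measurable
  have "(\<integral>\<^sup>+x. f x \<partial>?N') = (\<integral>\<^sup>+x. \<integral>\<^sup>+y. f (x(i := y)) \<partial>lborel \<partial>?N)"
    using insert by (intro product_nn_integral_insert) auto
  also have "\<dots> = (\<integral>\<^sup>+x. ennreal c * G x \<partial>?N)"
  proof (rule nn_integral_cong)
    fix x assume x: "x \<in> space ?N"
    have "(\<lambda>y. f (x(i := y))) \<in> borel_measurable borel"
      using measurable_compose[OF measurable_component_update[OF x insert.hyps(2)] insert.prems]
      by (simp add: fun_upd_def)
    then show "(\<integral>\<^sup>+y. f (x(i := y)) \<partial>lborel) = ennreal c * G x"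
      using c unfolding G_def by (subst nn_integral_real_affine[where c = c and t = "t i"]) auto
  qed
  also have "\<dots> = ennreal c * (\<integral>\<^sup>+x. G x \<partial>?N)" by (rule nn_integral_cmult) simp
  also have "(\<integral>\<^sup>+x. G x \<partial>?N) = ennreal (c ^ card I) * (\<integral>\<^sup>+x. G (\<lambda>j\<in>I. t j + c * x j) \<partial>?N)"
    by (rule insert.IH) simp
  also have "(\<integral>\<^sup>+x. G (\<lambda>j\<in>I. t j + c * x j) \<partial>?N) =
      (\<integral>\<^sup>+x. \<integral>\<^sup>+y. f (\<lambda>j\<in>insert i I. t j + c * (x(i := y)) j) \<partial>lborel \<partial>?N)"
    unfolding G_def
  proof (intro nn_integral_cong arg_cong[where f = f])
    fix x :: "'a \<Rightarrow> real" and y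
    show "(\<lambda>j\<in>I. t j + c * x j)(i := t i + c * y) = (\<lambda>j\<in>insert i I. t j + c * (x(i := y)) j)"
      using insert.hyps by auto
  qed
  also have "\<dots> = (\<integral>\<^sup>+x. f (\<lambda>j\<in>insert i I. t j + c * x j) \<partial>?N')"
    using insert.hyps by (intro product_nn_integral_insert[symmetric]) auto
  also have "ennreal c * (ennreal (c ^ card I) * \<dots>) = ennreal (c ^ card (insert i I)) * \<dots>"
  proof -
    have "ennreal (c ^ card (insert i I)) = ennreal c * ennreal (c ^ card I)"
      using insert.hyps c by (simp add: ennreal_mult)
    then show ?thesis by (simp only: mult.assoc)
  qed
  finally show ?case .
qed

text \<open>Chernoff bound.  Since the quadratic form of the inverse covariance dominates \<open>\<bar>d\<bar>\<^sup>2 / L\<close>, the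
  exponential moment \<open>exp (\<bar>d\<bar>\<^sup>2 / (4 L))\<close> times the density at distance \<open>d\<close> from the mean is at most
  the density at \<open>d / sqrt 2\<close>; rescaling costs \<open>sqrt 2 ^ p\<close>, and no determinant has to be computed.\<close>

lemma gaussian_norm_tail:
  assumes p: "0 < p" and M: "prob_space M" and pd: "pos_def_mat p S"
    and D: "distributed M (euclid p) Y (\<lambda>x. ennreal (mvn_density p \<mu> S x))"
    and L: "max_eigenvalue S \<le> L" and t: "0 \<le> t"
  shows "measure M {\<omega> \<in> space M. t < (\<Sum>j<p. (Y \<omega> j - \<mu> j)\<^sup>2)} \<le> sqrt 2 ^ p * exp (- t / (4 * L))"
proof -
  interpret prob_space M by fact
  let ?N = "euclid p" and ?A = "the (mat_inverse S)"
  define h where "h x = ennreal (mvn_density p \<mu> S x)" for x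
  define C where "C = sqrt ((2 * pi) ^ p * Determinant.det S)"
  note A = pos_def_mat_inverse[OF pd]
  have Lpos: "0 < L" using max_eigenvalue_bound(1)[OF p pd] L by simp
  have hN[measurable]: "h \<in> borel_measurable ?N" unfolding h_def using D by (simp add: distributed_def)
  have Y[measurable]: "Y \<in> M \<rightarrow>\<^sub>M ?N" using D by (simp add: distributed_def)
  have dens: "mvn_density p \<mu> S x = exp (- bform p ?A (\<lambda>j. x j - \<mu> j) (\<lambda>j. x j - \<mu> j) / 2) / C" for x
  proof -
    have "scalar_prod (Matrix.vec p (\<lambda>j. x j - \<mu> j)) (?A *\<^sub>v Matrix.vec p (\<lambda>j. x j - \<mu> j)) =
      scalar_prod (?A *\<^sub>v Matrix.vec p (\<lambda>j. x j - \<mu> j)) (Matrix.vec p (\<lambda>j. x j - \<mu> j))"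
      using A by (intro comm_scalar_prod[of _ p]) auto
    then show ?thesis using scalar_prod_mult_mat_vec[OF A(1), of "\<lambda>j. x j - \<mu> j" "\<lambda>j. x j - \<mu> j"]
      by (simp add: mvn_density_def Let_def C_def)
  qed
  have coord[measurable]: "(\<lambda>x. x j) \<in> borel_measurable ?N" if "j < p" for j
    using measurable_component_singleton[of j "{..<p}" "\<lambda>_. lborel :: real measure"] that
    by (simp add: euclid_def)
  have sq[measurable]: "(\<lambda>x. \<Sum>j<p. (x j - \<mu> j)\<^sup>2) \<in> borel_measurable ?N"
    by (intro borel_measurable_sum borel_measurable_power borel_measurable_diff coord) auto
  define e where "e x = ennreal (exp (((\<Sum>j<p. (x j - \<mu> j)\<^sup>2) - t) / (4 * L)))" for x :: "nat \<Rightarrow> real"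
  have e[measurable]: "e \<in> borel_measurable ?N" unfolding e_def by measurable
  \<comment> \<open>The mass comes from the law of \<open>Y\<close> being a probability; no Gaussian
    integral is evaluated.\<close>
  have int1: "(\<integral>\<^sup>+x. h x \<partial>?N) = 1"
    using distributed_nn_integral[OF D, of "\<lambda>_. 1"] emeasure_space_1 by (simp add: h_def)
  let ?s = "\<lambda>x. \<lambda>j\<in>{..<p}. \<mu> j + (x j - \<mu> j) / sqrt 2"
  have s[measurable]: "?s \<in> ?N \<rightarrow>\<^sub>M ?N"
    unfolding euclid_def by (rule measurable_restrict) measurable
  have pw: "h x * e x \<le> ennreal (exp (- t / (4 * L))) * h (?s x)" for x
  proof (cases "0 < C")
    case False
    \<comment> \<open>The sign of the determinant is left open here: if \<open>C\<close> is not
      positive, the density is at most 0 and \<open>ennreal\<close> turns it into 0.\<close>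
    then have "mvn_density p \<mu> S x \<le> 0" by (simp add: dens divide_nonneg_nonpos)
    then show ?thesis by (simp add: h_def ennreal_neg)
  next
    case True
    let ?d = "\<lambda>j. x j - \<mu> j"
    have "bform p ?A (\<lambda>j. ?s x j - \<mu> j) (\<lambda>j. ?s x j - \<mu> j) = bform p ?A (\<lambda>j. (1 / sqrt 2) * ?d j) (\<lambda>j. (1 / sqrt 2) * ?d j)"
      by (simp add: bform_def)
    also have "\<dots> = bform p ?A ?d ?d / 2" by (simp only: bform_scale) (simp add: power_divide)
    finally have sx: "mvn_density p \<mu> S (?s x) = exp (- bform p ?A ?d ?d / 4) / C" by (simp add: dens)
    have B: "(\<Sum>j<p. (?d j)\<^sup>2) \<le> L * bform p ?A ?d ?d"
    proof -
      have l: "(\<Sum>j<p. (?d j)\<^sup>2) \<le> max_eigenvalue S * bform p ?A ?d ?d"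
        by (rule inverse_bform_lower[OF p pd])
      have "0 \<le> (\<Sum>j<p. (?d j)\<^sup>2)" by (intro sum_nonneg) auto
      then have "0 \<le> bform p ?A ?d ?d" using l max_eigenvalue_bound(1)[OF p pd] by (meson order_trans zero_le_mult_iff not_le)
      then show ?thesis using l L by (meson mult_right_mono order_trans)
    qed
    then have "(\<Sum>j<p. (?d j)\<^sup>2) / (4 * L) \<le> bform p ?A ?d ?d / 4" using Lpos by (simp add: field_simps)
    then have "exp (- bform p ?A ?d ?d / 2) * exp (((\<Sum>j<p. (?d j)\<^sup>2) - t) / (4 * L)) \<le>
       exp (- t / (4 * L)) * exp (- bform p ?A ?d ?d / 4)"
      unfolding exp_add[symmetric] by (simp add: diff_divide_distrib)
    then have "mvn_density p \<mu> S x * exp (((\<Sum>j<p. (?d j)\<^sup>2) - t) / (4 * L)) \<le> exp (- t / (4 * L)) * mvn_density p \<mu> S (?s x)"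
      unfolding sx using True by (simp add: dens divide_right_mono)
    then show ?thesis using True unfolding h_def e_def
      by (simp add: ennreal_mult'[symmetric] ennreal_leI dens)
  qed
  have sc: "(\<integral>\<^sup>+x. h (?s x) \<partial>?N) = ennreal (sqrt 2 ^ p)"
  proof -
    \<comment> \<open>The substitution is the inverse of \<open>?s\<close>, the contraction by
      \<open>1 / sqrt 2\<close> about the mean.\<close>
    have "(\<integral>\<^sup>+x. h (?s x) \<partial>?N) = ennreal (sqrt 2 ^ p) * (\<integral>\<^sup>+x. h (?s (\<lambda>j\<in>{..<p}. (\<mu> j - sqrt 2 * \<mu> j) + sqrt 2 * x j)) \<partial>?N)"
      using nn_integral_PiM_lborel_affine[of "{..<p}" "sqrt 2" "\<lambda>x. h (?s x)" "\<lambda>j. \<mu> j - sqrt 2 * \<mu> j"] measurable_compose[OF s hN]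
      by (simp add: euclid_def)
    also have "(\<integral>\<^sup>+x. h (?s (\<lambda>j\<in>{..<p}. (\<mu> j - sqrt 2 * \<mu> j) + sqrt 2 * x j)) \<partial>?N) = (\<integral>\<^sup>+x. h x \<partial>?N)"
    proof (intro nn_integral_cong arg_cong[where f = h])
      fix x assume x: "x \<in> space ?N"
      show "?s (\<lambda>j\<in>{..<p}. (\<mu> j - sqrt 2 * \<mu> j) + sqrt 2 * x j) = x"
      proof
        fix j show "?s (\<lambda>j\<in>{..<p}. (\<mu> j - sqrt 2 * \<mu> j) + sqrt 2 * x j) j = x j"
          using x by (auto simp: euclid_def space_PiM PiE_def extensional_def field_simps)
      qed
    qed
    finally show ?thesis by (simp only: int1 mult_1_right)
  qed
  let ?B = "{\<omega> \<in> space M. t < (\<Sum>j<p. (Y \<omega> j - \<mu> j)\<^sup>2)}"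
  have B: "?B \<in> sets M" using measurable_compose[OF Y sq] by measurable
  have "emeasure M ?B = (\<integral>\<^sup>+\<omega>. indicator ?B \<omega> \<partial>M)" using B by simp
  also have "\<dots> \<le> (\<integral>\<^sup>+\<omega>. e (Y \<omega>) \<partial>M)"
  proof (rule nn_integral_mono)
    fix \<omega> show "indicator ?B \<omega> \<le> e (Y \<omega>)"
    proof (cases "\<omega> \<in> ?B")
      case True
      then have "0 \<le> ((\<Sum>j<p. (Y \<omega> j - \<mu> j)\<^sup>2) - t) / (4 * L)" using Lpos by simp
      then have "1 \<le> exp (((\<Sum>j<p. (Y \<omega> j - \<mu> j)\<^sup>2) - t) / (4 * L))" by simp
      then show ?thesis using True by (simp add: e_def del: one_le_exp_iff)
    qed simp
  qed
  also have "\<dots> = (\<integral>\<^sup>+x. h x * e x \<partial>?N)" unfolding h_def by (rule distributed_nn_integral[OF D e, symmetric])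
  also have "\<dots> \<le> (\<integral>\<^sup>+x. ennreal (exp (- t / (4 * L))) * h (?s x) \<partial>?N)" by (intro nn_integral_mono pw)
  also have "\<dots> = ennreal (exp (- t / (4 * L))) * ennreal (sqrt 2 ^ p)"
    using measurable_compose[OF s hN] by (subst nn_integral_cmult) (simp_all add: sc)
  also have "\<dots> = ennreal (sqrt 2 ^ p * exp (- t / (4 * L)))" by (simp add: ennreal_mult'[symmetric] mult.commute)
  finally show ?thesis by (simp add: emeasure_eq_measure)
qed

section \<open>Posterior consistency\<close>

lemma euclid_dist_nonneg: "0 \<le> euclid_dist p x z"
  by (simp add: euclid_dist_def L2_set_nonneg)

lemma euclid_dist_commute: "euclid_dist p x z = euclid_dist p z x"
  by (simp add: euclid_dist_def L2_set_def power2_commute)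

lemma euclid_dist_triangle: "euclid_dist p x z \<le> euclid_dist p x w + euclid_dist p w z"
  using L2_set_triangle_ineq[of "\<lambda>j. x j - w j" "\<lambda>j. w j - z j" "{..<p}"]
  by (simp add: euclid_dist_def)

text \<open>At squared distance at most \<open>\<sigma>^2 * ln \<rho> / 2\<close> the exponential in
  the edge weight is at least \<rho> to the power -1/4, against \<rho> to the power -1 for a root: a
  gain of the power 3/4. Beyond \<open>4 * (\<sigma>^2 * ln \<rho>)\<close> it is at most \<rho> to
  the power -2, and a root gains a full power. The factor \<open>sqrt (2 * pi) ^ p\<close> hurts the
  first bound and may be dropped from the second.\<close>

lemma edge_weight_bounds:
  assumes \<sigma>: "\<sigma> > 0" and \<rho>: "\<rho> > 0" and C1: "C1 > 0" and C2: "C2 > 0"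
    and root: "C1 / (\<rho> * \<sigma> ^ p) \<le> c" "c \<le> C2 / (\<rho> * \<sigma> ^ p)"
  shows "(euclid_dist p (y i) (y j))\<^sup>2 \<le> \<sigma>\<^sup>2 * ln \<rho> / 2 \<Longrightarrow>
      c \<le> C2 * sqrt (2 * pi) ^ p * exp (- 3 / 4 * ln \<rho>) * edge_weight p \<sigma> y i j"
    and "4 * (\<sigma>\<^sup>2 * ln \<rho>) \<le> (euclid_dist p (y i) (y j))\<^sup>2 \<Longrightarrow>
      edge_weight p \<sigma> y i j \<le> 1 / (C1 * \<rho>) * c"
proof -
  let ?d = "euclid_dist p (y i) (y j)"
  have ew: "edge_weight p \<sigma> y i j = exp (- ?d\<^sup>2 / (2 * \<sigma>\<^sup>2)) / (sqrt (2 * pi) ^ p * \<sigma> ^ p)"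
    by (simp add: edge_weight_def power_mult_distrib)
  have pp: "0 < sqrt (2 * pi) ^ p" and sp: "0 < \<sigma> ^ p" using \<sigma> by simp_all
  show "c \<le> C2 * sqrt (2 * pi) ^ p * exp (- 3 / 4 * ln \<rho>) * edge_weight p \<sigma> y i j"
    if d: "?d\<^sup>2 \<le> \<sigma>\<^sup>2 * ln \<rho> / 2"
  proof -
    have "?d\<^sup>2 / (2 * \<sigma>\<^sup>2) \<le> ln \<rho> / 4" using d \<sigma> by (simp add: field_simps)
    then have "exp (- ln \<rho>) \<le> exp (- 3 / 4 * ln \<rho>) * exp (- ?d\<^sup>2 / (2 * \<sigma>\<^sup>2))"
      unfolding exp_add[symmetric] by simp
    then have "inverse \<rho> \<le> exp (- 3 / 4 * ln \<rho>) * exp (- ?d\<^sup>2 / (2 * \<sigma>\<^sup>2))"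
      using \<rho> by (simp add: exp_minus)
    then have "C2 * inverse \<rho> / \<sigma> ^ p \<le> C2 * (exp (- 3 / 4 * ln \<rho>) * exp (- ?d\<^sup>2 / (2 * \<sigma>\<^sup>2))) / \<sigma> ^ p"
      using C2 sp by (intro divide_right_mono mult_left_mono) auto
    moreover have "C2 * sqrt (2 * pi) ^ p * exp (- 3 / 4 * ln \<rho>) * edge_weight p \<sigma> y i j =
        C2 * (exp (- 3 / 4 * ln \<rho>) * exp (- ?d\<^sup>2 / (2 * \<sigma>\<^sup>2))) / \<sigma> ^ p"
      unfolding ew using pp by simp
    moreover have "C2 * inverse \<rho> / \<sigma> ^ p = C2 / (\<rho> * \<sigma> ^ p)" by (simp add: divide_inverse)
    ultimately show ?thesis using root(2) by linarith
  qed
  show "edge_weight p \<sigma> y i j \<le> 1 / (C1 * \<rho>) * c" if d: "4 * (\<sigma>\<^sup>2 * ln \<rho>) \<le> ?d\<^sup>2"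
  proof -
    have "2 * ln \<rho> \<le> ?d\<^sup>2 / (2 * \<sigma>\<^sup>2)" using d \<sigma> by (simp add: field_simps)
    then have "exp (- ?d\<^sup>2 / (2 * \<sigma>\<^sup>2)) \<le> exp (- ln \<rho>) * exp (- ln \<rho>)"
      unfolding exp_add[symmetric] by simp
    then have e: "exp (- ?d\<^sup>2 / (2 * \<sigma>\<^sup>2)) \<le> inverse \<rho> * inverse \<rho>" using \<rho> by (simp add: exp_minus)
    have "1 \<le> sqrt (2 * pi)" using pi_gt3 by simp
    then have "1 \<le> sqrt (2 * pi) ^ p" by (rule one_le_power)
    then have "edge_weight p \<sigma> y i j \<le> (inverse \<rho> * inverse \<rho>) / (1 * \<sigma> ^ p)"
      unfolding ew using sp e by (intro frac_le mult_right_mono mult_pos_pos) auto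
    also have "\<dots> = 1 / (C1 * \<rho>) * (C1 / (\<rho> * \<sigma> ^ p))" using C1 by (simp add: field_simps)
    also have "\<dots> \<le> 1 / (C1 * \<rho>) * c" using root(1) C1 \<rho> by (intro mult_left_mono) auto
    finally show ?thesis .
  qed
qed

text \<open>A bound for fixed \<open>n\<close>: the posterior error is at most 1 on the bad event
  and deterministically small off it. Means and covariances are indexed by observation, so that
  \<open>same\<close> and \<open>sep\<close> are the only link between the means and the
  partition.\<close>

lemma expected_error_bound:
  fixes M :: "'w measure" and y :: "nat \<Rightarrow> 'w \<Rightarrow> nat \<Rightarrow> real" and m :: "nat \<Rightarrow> nat \<Rightarrow> real"
  assumes p: "0 < p" and pos: "\<sigma> > 0" "\<delta> > 0" "lam > 0" and \<rho>: "\<rho> = 1 / (\<delta> * lam * \<sigma> ^ p)"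
    and \<rho>1: "1 < \<rho>" and M: "prob_space M" and C: "C1 > 0" "C2 > 0"
    and Vs: "Vs \<in> ordered_partitions n"
    and r_pos: "\<And>x. x \<in> space (euclid p) \<Longrightarrow> r x > 0"
    and root: "AE \<omega> in M. \<forall>i\<in>{1..n}. C1 * \<delta> \<le> r (y i \<omega>) \<and> r (y i \<omega>) \<le> C2 * \<delta>"
    and pd: "\<And>i. i \<in> {1..n} \<Longrightarrow> pos_def_mat p (S i)"
    and D: "\<And>i. i \<in> {1..n} \<Longrightarrow> distributed M (euclid p) (y i) (\<lambda>x. ennreal (mvn_density p (m i) (S i) x))"
    and L: "\<And>i. i \<in> {1..n} \<Longrightarrow> max_eigenvalue (S i) \<le> L"
    and same: "\<And>V i j. V \<in> set Vs \<Longrightarrow> i \<in> V \<Longrightarrow> j \<in> V \<Longrightarrow> m i = m j"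
    and sep: "\<And>i j. i \<in> {1..n} \<Longrightarrow> j \<in> {1..n} \<Longrightarrow> (\<nexists>V. V \<in> set Vs \<and> i \<in> V \<and> j \<in> V) \<Longrightarrow>
      25 * (\<sigma>\<^sup>2 * ln \<rho>) \<le> (euclid_dist p (m i) (m j))\<^sup>2"
  defines "\<tau> \<equiv> 1 / (C1 * \<rho>)" and "\<eta> \<equiv> C2 * sqrt (2 * pi) ^ p * exp (- 3 / 4 * ln \<rho>)"
  shows "0 \<le> (\<integral>\<omega>. bsf_prob_not_equiv n p \<sigma> lam r (\<lambda>i. y i \<omega>) Vs \<partial>M)"
    and "(\<integral>\<omega>. bsf_prob_not_equiv n p \<sigma> lam r (\<lambda>i. y i \<omega>) Vs \<partial>M) \<le>
      real n * (sqrt 2 ^ p * exp (- (\<sigma>\<^sup>2 * ln \<rho>) / (32 * L))) + real n * (real n * \<tau> + real n * \<eta> * (1 + \<tau>))"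
proof -
  interpret prob_space M by fact
  let ?g = "\<lambda>\<omega>. bsf_prob_not_equiv n p \<sigma> lam r (\<lambda>i. y i \<omega>) Vs"
  define l where "l = \<sigma>\<^sup>2 * ln \<rho>"
  have l: "0 < l" using pos \<rho>1 by (simp add: l_def)
  define E where "E = real n * (real n * \<tau> + real n * \<eta> * (1 + \<tau>))"
  have \<tau>0: "0 \<le> \<tau>" and \<eta>0: "0 \<le> \<eta>" using C \<rho>1 by (simp_all add: \<tau>_def \<eta>_def)
  have E0: "0 \<le> E" using \<tau>0 \<eta>0 by (simp add: E_def)
  have Y: "y i \<in> M \<rightarrow>\<^sub>M euclid p" if "i \<in> {1..n}" for i using D[OF that] by (simp add: distributed_def)
  have rp: "r (y i \<omega>) > 0" if "i \<in> {1..n}" "\<omega> \<in> space M" for i \<omega>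
    by (rule r_pos[OF measurable_space[OF Y[OF that(1)] that(2)]])
  have rng: "0 \<le> ?g \<omega>" "?g \<omega> \<le> 1" if "\<omega> \<in> space M" for \<omega>
    using bsf_prob_not_equiv_range[where y = "\<lambda>i. y i \<omega>" and r = r, OF pos(1,3) _ Vs] rp that by auto
  show "0 \<le> (\<integral>\<omega>. ?g \<omega> \<partial>M)" using rng by (intro Bochner_Integration.integral_nonneg_AE) auto
  \<comment> \<open>With each observation within \<open>sqrt (l / 8)\<close> of its mean, two with
    the same mean are within \<open>sqrt (l / 2)\<close>, the threshold of
    \<open>edge_weight_bounds\<close>. The tail bound at \<open>l / 8\<close> yields the exponent
    \<open>l / (32 * L)\<close>.\<close>
  define B where "B i = {\<omega> \<in> space M. l / 8 < (\<Sum>j<p. (y i \<omega> j - m i j)\<^sup>2)}" for i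
  define Bad where "Bad = (\<Union>i\<in>{1..n}. B i)"
  have B_sets: "B i \<in> sets M" if "i \<in> {1..n}" for i
  proof -
    have "(\<lambda>x. x j) \<in> borel_measurable (euclid p)" if "j < p" for j
      using measurable_component_singleton[of j "{..<p}" "\<lambda>_. lborel :: real measure"] that
      by (simp add: euclid_def)
    then have "(\<lambda>\<omega>. y i \<omega> j) \<in> borel_measurable M" if "j < p" for j
      using measurable_compose[OF Y[OF \<open>i \<in> {1..n}\<close>]] that by blast
    then have "(\<lambda>\<omega>. \<Sum>j<p. (y i \<omega> j - m i j)\<^sup>2) \<in> borel_measurable M"
      by (intro borel_measurable_sum borel_measurable_power borel_measurable_diff) auto
    then show ?thesis unfolding B_def by measurable
  qed
  have Bad_sets: "Bad \<in> sets M" unfolding Bad_def using B_sets by (intro sets.finite_UN) auto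
  have PB: "measure M (B i) \<le> sqrt 2 ^ p * exp (- l / (32 * L))" if i: "i \<in> {1..n}" for i
    using gaussian_norm_tail[OF p M pd[OF i] D[OF i] L[OF i], of "l / 8"] l by (simp add: B_def)
  have "measure M Bad \<le> (\<Sum>i\<in>{1..n}. measure M (B i))"
    unfolding Bad_def using B_sets by (intro finite_measure_subadditive_finite) auto
  also have "\<dots> \<le> real n * (sqrt 2 ^ p * exp (- l / (32 * L)))"
    using sum_mono[of "{1..n}" "\<lambda>i. measure M (B i)" "\<lambda>_. sqrt 2 ^ p * exp (- l / (32 * L))"] PB by simp
  finally have PBad: "measure M Bad \<le> real n * (sqrt 2 ^ p * exp (- l / (32 * L)))" .
  have ptw: "?g \<omega> \<le> indicator Bad \<omega> + E"
    if \<omega>: "\<omega> \<in> space M" and rt: "\<forall>i\<in>{1..n}. C1 * \<delta> \<le> r (y i \<omega>) \<and> r (y i \<omega>) \<le> C2 * \<delta>" for \<omega>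
  proof (cases "\<omega> \<in> Bad")
    case True
    then show ?thesis using rng(2)[OF \<omega>] E0 by simp
  next
    case False
    let ?d = "\<lambda>i j. euclid_dist p (y i \<omega>) (y j \<omega>)"
    define s where "s = sqrt l"
    have s: "0 < s" "s\<^sup>2 = l" using l by (simp_all add: s_def)
    have near: "euclid_dist p (y i \<omega>) (m i) \<le> s / sqrt 8" if "i \<in> {1..n}" for i
    proof -
      have "(\<Sum>j<p. (y i \<omega> j - m i j)\<^sup>2) \<le> l / 8" using False \<omega> that by (auto simp: Bad_def B_def not_less)
      then have "euclid_dist p (y i \<omega>) (m i) \<le> sqrt (l / 8)" by (simp add: euclid_dist_def L2_set_def)
      then show ?thesis by (simp add: s_def real_sqrt_divide)
    qed
    have lr: "\<delta> * lam = 1 / (\<rho> * \<sigma> ^ p)" using pos by (simp add: \<rho> field_simps)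
    have w: "C1 / (\<rho> * \<sigma> ^ p) \<le> lam * r (y i \<omega>)" "lam * r (y i \<omega>) \<le> C2 / (\<rho> * \<sigma> ^ p)" if "i \<in> {1..n}" for i
    proof -
      have "lam * (C1 * \<delta>) \<le> lam * r (y i \<omega>)" "lam * r (y i \<omega>) \<le> lam * (C2 * \<delta>)"
        using rt that pos by (auto intro: mult_left_mono)
      moreover have "lam * (C * \<delta>) = C / (\<rho> * \<sigma> ^ p)" for C 
      proof -
        have "lam * (C * \<delta>) = C * (\<delta> * lam)" by simp
        then show ?thesis unfolding lr by simp
      qed
      ultimately show "C1 / (\<rho> * \<sigma> ^ p) \<le> lam * r (y i \<omega>)" "lam * r (y i \<omega>) \<le> C2 / (\<rho> * \<sigma> ^ p)" by simp_all
    qed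
    have \<rho>0: "0 < \<rho>" using \<rho>1 by simp
    have P: "partition_on {1..n} (set Vs)" using Vs by (simp add: ordered_partitions_def)
    have "?g \<omega> \<le> real n * (real n * \<tau> + real n * \<eta> * (1 + \<tau>))"
    proof (rule bsf_prob_not_equiv_le[OF pos(1,3) _ Vs _ _ \<tau>0 \<eta>0])
      fix i assume "i \<in> {1..n}" then show "0 < r (y i \<omega>)" using rp \<omega> by blast
    next
      fix i j assume i: "i \<in> {1..n}" and j: "j \<in> {1..n}" and V: "\<nexists>V. V \<in> set Vs \<and> i \<in> V \<and> j \<in> V"
      \<comment> \<open>Means at least \<open>5 * s\<close> apart leave at least
        \<open>3 * s\<close> between the observations, more than the \<open>2 * s\<close> required;
        this is the origin of the constant 25.\<close>
      have "(5 * s)\<^sup>2 \<le> (euclid_dist p (m i) (m j))\<^sup>2" using sep[OF i j V] by (simp add: power_mult_distrib s l_def)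
      then have "5 * s \<le> euclid_dist p (m i) (m j)" by (rule power2_le_imp_le[OF _ euclid_dist_nonneg])
      also have "\<dots> \<le> euclid_dist p (m i) (y i \<omega>) + euclid_dist p (y i \<omega>) (m j)" by (rule euclid_dist_triangle)
      also have "\<dots> \<le> euclid_dist p (m i) (y i \<omega>) + (?d i j + euclid_dist p (y j \<omega>) (m j))"
        by (intro add_left_mono euclid_dist_triangle)
      also have "\<dots> \<le> s / sqrt 8 + (?d i j + s / sqrt 8)"
        using near[OF i] near[OF j] by (intro add_mono) (auto simp: euclid_dist_commute)
      finally have "5 * s \<le> 2 * (s / sqrt 8) + ?d i j" by simp
      moreover have "s / sqrt 8 \<le> s" using s by (simp add: divide_le_eq)
      ultimately have "2 * s \<le> ?d i j" using s by linarith
      then have "(2 * s)\<^sup>2 \<le> (?d i j)\<^sup>2" using s by (intro power_mono) auto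
      then have "4 * (\<sigma>\<^sup>2 * ln \<rho>) \<le> (?d i j)\<^sup>2" by (simp add: power_mult_distrib s l_def)
      then show "edge_weight p \<sigma> (\<lambda>i. y i \<omega>) i j \<le> \<tau> * (lam * r (y i \<omega>))"
        unfolding \<tau>_def by (intro edge_weight_bounds(2)[OF pos(1) \<rho>0 C w[OF i]])
    next
      fix i j V assume V: "V \<in> set Vs" "i \<in> V" "j \<in> V"
      have ij: "i \<in> {1..n}" "j \<in> {1..n}" using V partition_onD1[OF P] by blast+
      have "?d i j \<le> euclid_dist p (y i \<omega>) (m i) + euclid_dist p (m j) (y j \<omega>)"
        using euclid_dist_triangle[of p "y i \<omega>" "y j \<omega>" "m i"] same[OF V] by simp
      also have "\<dots> \<le> s / sqrt 8 + s / sqrt 8"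
        using near[OF ij(1)] near[OF ij(2)] by (intro add_mono) (auto simp: euclid_dist_commute)
      also have "\<dots> = 2 * s / sqrt 8" by simp
      finally have "(?d i j)\<^sup>2 \<le> (2 * s / sqrt 8)\<^sup>2" by (rule power_mono[OF _ euclid_dist_nonneg])
      then have "(?d i j)\<^sup>2 \<le> \<sigma>\<^sup>2 * ln \<rho> / 2" by (simp add: power_mult_distrib power_divide s l_def mult.commute)
      then show "lam * r (y i \<omega>) \<le> \<eta> * edge_weight p \<sigma> (\<lambda>i. y i \<omega>) i j"
        unfolding \<eta>_def by (intro edge_weight_bounds(1)[OF pos(1) \<rho>0 C w[OF ij(1)]])
    qed
    then show ?thesis using False by (simp add: E_def)
  qed
  show "(\<integral>\<omega>. ?g \<omega> \<partial>M) \<le> real n * (sqrt 2 ^ p * exp (- (\<sigma>\<^sup>2 * ln \<rho>) / (32 * L))) + real n * (real n * \<tau> + real n * \<eta> * (1 + \<tau>))"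
  proof (cases "integrable M ?g")
    case True
    have intB: "integrable M (indicator Bad :: _ \<Rightarrow> real)"
      by (rule integrable_real_indicator[OF Bad_sets]) (simp add: emeasure_eq_measure)
    then have int: "integrable M (\<lambda>\<omega>. indicator Bad \<omega> + E :: real)"
      by (intro Bochner_Integration.integrable_add integrable_const)
    have "(\<integral>\<omega>. ?g \<omega> \<partial>M) \<le> (\<integral>\<omega>. indicator Bad \<omega> + E \<partial>M)"
      using root ptw by (intro integral_mono_AE True int) auto
    also have "\<dots> = measure M Bad + E"
      using intB Bad_sets prob_space by (subst Bochner_Integration.integral_add) simp_all
    finally show ?thesis using PBad unfolding E_def l_def by linarith
  next
    \<comment> \<open>This spares a proof that the posterior is measurable.\<close>
    case False
    then have "(\<integral>\<omega>. ?g \<omega> \<partial>M) = 0" by (rule not_integrable_integral_eq)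
    then show ?thesis using E0 unfolding E_def by simp
  qed
qed

text \<open>The label function \<open>\<kappa>\<close> turns sharing a block into equality of
  labels, which moves parameters indexed by blocks to single observations.\<close>

lemma oracle_partition_facts:
  assumes V0: "oracle_family V0" and n: "1 \<le> n"
  obtains \<kappa> where "1 \<le> K0 V0 n"
    and "\<And>i. i \<in> {1..n} \<Longrightarrow> \<kappa> i \<in> {1..K0 V0 n} \<and> i \<in> oracle_block V0 n (\<kappa> i)"
    and "\<And>i j V. V \<in> set (oracle_partition V0 n) \<Longrightarrow> i \<in> V \<Longrightarrow> j \<in> V \<Longrightarrow> \<kappa> i = \<kappa> j"
    and "\<And>i j. i \<in> {1..n} \<Longrightarrow> j \<in> {1..n} \<Longrightarrow> \<kappa> i = \<kappa> j \<Longrightarrow> \<exists>V. V \<in> set (oracle_partition V0 n) \<and> i \<in> V \<and> j \<in> V"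
proof -
  let ?K = "K0 V0 n" and ?b = "oracle_block V0 n"
  have op: "oracle_partition V0 n \<in> ordered_partitions n" by (rule oracle_partition_in_ordered_partitions[OF V0])
  have set_op: "set (oracle_partition V0 n) = ?b ` {1..?K}" by (auto simp: oracle_partition_def simp del: upt_Suc)
  have P: "partition_on {1..n} (?b ` {1..?K})" using op by (simp add: ordered_partitions_def set_op)
  have "distinct (map ?b [1..<Suc ?K])" using op by (simp add: ordered_partitions_def oracle_partition_def)
  then have inj: "inj_on ?b {1..?K}" unfolding distinct_map by (simp add: atLeastLessThanSuc_atLeastAtMost del: upt_Suc)
  have uniq: "k = l" if "k \<in> {1..?K}" "l \<in> {1..?K}" "i \<in> ?b k" "i \<in> ?b l" for i k l
  proof -
    have "?b k = ?b l \<or> ?b k \<inter> ?b l = {}"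
      using disjointD[OF partition_onD2[OF P], of "?b k" "?b l"] that(1,2) by blast
    then have "?b k = ?b l" using that(3,4) by auto
    then show ?thesis by (rule inj_onD[OF inj _ that(1,2)])
  qed
  have "\<forall>i\<in>{1..n}. \<exists>k. k \<in> {1..?K} \<and> i \<in> ?b k"
    using partition_onD1[OF P] by blast
  then obtain \<kappa> where \<kappa>: "\<And>i. i \<in> {1..n} \<Longrightarrow> \<kappa> i \<in> {1..?K} \<and> i \<in> ?b (\<kappa> i)" by metis
  show thesis
  proof (rule that)
    show "1 \<le> ?K" using \<kappa>[of 1] n by auto
    show "\<kappa> i \<in> {1..?K} \<and> i \<in> ?b (\<kappa> i)" if "i \<in> {1..n}" for i using \<kappa>[OF that] .
    show "\<kappa> i = \<kappa> j" if V: "V \<in> set (oracle_partition V0 n)" "i \<in> V" "j \<in> V" for i j V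
    proof -
      obtain k where k: "k \<in> {1..?K}" "V = ?b k" using V set_op by auto
      have "V \<subseteq> {1..n}" using partition_onD1[OF P] k by blast
      then have "\<kappa> i = k" "\<kappa> j = k" using uniq[of "\<kappa> i" k i] uniq[of "\<kappa> j" k j] \<kappa>[of i] \<kappa>[of j] V k by auto
      then show ?thesis by simp
    qed
    show "\<exists>V. V \<in> set (oracle_partition V0 n) \<and> i \<in> V \<and> j \<in> V"
      if "i \<in> {1..n}" "j \<in> {1..n}" "\<kappa> i = \<kappa> j" for i j
      using \<kappa>[OF that(1)] \<kappa>[OF that(2)] that(3) unfolding set_op by (intro exI[of _ "?b (\<kappa> i)"]) auto
  qed
qed

text \<open>The two labels make the minimum finite, and a zero minimum would make the quotient
  infinite. What remains is a real inequality.\<close>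

lemma D_min_separation:
  assumes small: "ereal x / (D_min p K \<mu>)\<^sup>2 < ereal (1 / 25)" and x: "0 < x"
    and k: "k \<in> {1..K}" "l \<in> {1..K}" "k \<noteq> l"
  shows "25 * x \<le> (euclid_dist p (\<mu> k) (\<mu> l))\<^sup>2"
proof -
  have le: "D_min p K \<mu> \<le> ereal (euclid_dist p (\<mu> k) (\<mu> l))"
    unfolding D_min_def using k by (intro INF_lower2[of "(k, l)"]) auto
  have ge: "0 \<le> D_min p K \<mu>"
    unfolding D_min_def by (rule INF_greatest) (auto simp: euclid_dist_nonneg)
  obtain d where d: "D_min p K \<mu> = ereal d" "0 \<le> d" "d \<le> euclid_dist p (\<mu> k) (\<mu> l)"
    using le ge by (cases "D_min p K \<mu>") auto
  have "d \<noteq> 0"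
  proof
    assume "d = 0"
    then have "ereal x / (D_min p K \<mu>)\<^sup>2 = \<infinity>" using x d
      by (simp add: zero_ereal_def[symmetric] power2_eq_square divide_ereal_def)
    then show False using small by simp
  qed
  then have "x / d\<^sup>2 < 1 / 25" using small d by (simp add: power2_eq_square)
  then have "25 * x \<le> d\<^sup>2" using \<open>d \<noteq> 0\<close> by (simp add: divide_less_eq)
  also have "\<dots> \<le> (euclid_dist p (\<mu> k) (\<mu> l))\<^sup>2" using d by (intro power_mono) auto
  finally show ?thesis .
qed

section \<open>Asymptotics of the two error terms\<close>

lemma sqrt_two_pi_power_le: "sqrt (2 * pi) ^ p \<le> exp (2 * real p)"
proof -
  have "sqrt (2 * pi) \<le> sqrt (3\<^sup>2)" using pi_less_4 by (intro real_sqrt_le_mono) simp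
  also have "\<dots> \<le> exp 2" using exp_ge_add_one_self[of 2] by simp
  finally have "sqrt (2 * pi) ^ p \<le> exp 2 ^ p" by (intro power_mono) auto
  then show ?thesis by (simp add: exp_of_nat_mult[symmetric] mult.commute)
qed

lemma sqrt_two_power_le: "sqrt 2 ^ p \<le> exp (real p)"
proof -
  have "sqrt 2 \<le> sqrt (2\<^sup>2)" by (intro real_sqrt_le_mono) simp
  also have "\<dots> \<le> exp 1" using exp_ge_add_one_self[of 1] by simp
  finally have "sqrt 2 ^ p \<le> exp 1 ^ p" by (intro power_mono) auto
  then show ?thesis by (simp add: exp_of_nat_mult[symmetric])
qed

text \<open>As 128 = 4 * 32, the hypothesis makes the exponent at least four times the maximum,
  hence at least \<open>p + 2 * ln n\<close>: \<open>p\<close> pays for \<open>sqrt 2 ^ p\<close>,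
  one \<open>ln n\<close> for the union bound, and the other leaves \<open>1 / n\<close>.\<close>

lemma tail_bound_le:
  assumes q: "0 < q" and L: "0 < L" and n: "1 \<le> n" and h: "L * max (real p) (ln (real n)) / q \<le> 1 / 128"
  shows "real n * (sqrt 2 ^ p * exp (- q / (32 * L))) \<le> 1 / real n"
proof -
  have "128 * (L * max (real p) (ln (real n))) \<le> q" using h q by (simp add: divide_le_eq)
  then have "4 * max (real p) (ln (real n)) \<le> q / (32 * L)" using L by (simp add: le_divide_eq algebra_simps)
  then have e: "- q / (32 * L) \<le> - real p - 2 * ln (real n)" by linarith
  have "sqrt 2 ^ p * exp (- q / (32 * L)) \<le> exp (real p) * exp (- real p - 2 * ln (real n))"
    using e sqrt_two_power_le by (intro mult_mono) auto
  also have "\<dots> = inverse (real n) * inverse (real n)"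
    using n unfolding exp_add[symmetric] by (simp add: exp_minus exp_double power2_eq_square)
  finally show ?thesis using n by (simp add: field_simps)
qed

text \<open>Since \<open>ln 2 \<ge> 2 / 3\<close>, \<open>ln \<rho>\<close> is at least
  \<open>ln c + 2 * n / 3\<close>. This gives \<tau> the rate \<open>n / 2\<close> with room to
  spare. For \<eta> the exponent is at most \<open>2 * p - n / 2\<close> up to a constant, and
  \<open>p \<le> n / 20\<close> turns it into \<open>- 2 / 5 * n\<close>.\<close>

lemma ratio_bound_le:
  fixes c :: real
  assumes c: "0 < c" and \<rho>: "c * 2 ^ n \<le> \<rho>" and C: "0 < C1" "0 < C2" and p: "real p \<le> real n / 20"
  defines "\<tau> \<equiv> 1 / (C1 * \<rho>)" and "\<eta> \<equiv> C2 * sqrt (2 * pi) ^ p * exp (- 3 / 4 * ln \<rho>)"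
  shows "real n * (real n * \<tau> + real n * \<eta> * (1 + \<tau>)) \<le>
    real n ^ 2 * (1 / (C1 * c) * exp (- real n / 2) + C2 * exp (- 3 / 4 * ln c) * exp (- 2 / 5 * real n) * (1 + 1 / (C1 * c)))"
proof -
  have \<rho>0: "0 < \<rho>" using c \<rho> by (meson less_le_trans mult_pos_pos zero_less_numeral zero_less_power)
  have "ln c + real n * ln 2 = ln (c * 2 ^ n)" using c by (simp add: ln_mult ln_realpow)
  also have "\<dots> \<le> ln \<rho>" using \<rho> c by (intro ln_mono) auto
  finally have ln\<rho>: "ln c + real n * (2 / 3) \<le> ln \<rho>"
    using mult_left_mono[OF ln2_ge_two_thirds, of "real n"] by linarith
  have \<tau>: "\<tau> \<le> 1 / (C1 * c) * exp (- real n / 2)"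
  proof -
    have "1 / \<rho> = exp (- ln \<rho>)" using \<rho>0 by (simp add: exp_minus divide_inverse)
    also have "\<dots> \<le> exp (- ln c + - real n / 2)"
      unfolding exp_le_cancel_iff using ln\<rho> by linarith
    also have "\<dots> = 1 / c * exp (- real n / 2)" 
    proof -
      have "exp (- ln c) = 1 / c" using c by (simp add: exp_minus inverse_eq_divide)
      then show ?thesis by (simp only: exp_add)
    qed
    finally have "1 / C1 * (1 / \<rho>) \<le> 1 / C1 * (1 / c * exp (- real n / 2))" using C by (intro mult_left_mono) auto
    then show ?thesis by (simp add: \<tau>_def)
  qed
  have "1 / (C1 * c) * exp (- real n / 2) \<le> 1 / (C1 * c) * 1" using C c by (intro mult_left_mono) auto
  then have \<tau>1: "\<tau> \<le> 1 / (C1 * c)" using \<tau> by simp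
  have \<tau>0: "0 \<le> \<tau>" using C \<rho>0 by (simp add: \<tau>_def)
  have \<eta>: "\<eta> \<le> C2 * exp (- 3 / 4 * ln c) * exp (- 2 / 5 * real n)"
  proof -
    have "sqrt (2 * pi) ^ p * exp (- 3 / 4 * ln \<rho>) \<le> exp (2 * real p) * exp (- 3 / 4 * ln \<rho>)"
      by (intro mult_right_mono sqrt_two_pi_power_le) auto
    also have "\<dots> \<le> exp (- 3 / 4 * ln c) * exp (- 2 / 5 * real n)"
      unfolding exp_add[symmetric] exp_le_cancel_iff using ln\<rho> p by linarith
    finally show ?thesis using C by (simp add: \<eta>_def mult.assoc)
  qed
  have "\<tau> + \<eta> * (1 + \<tau>) \<le> 1 / (C1 * c) * exp (- real n / 2) + C2 * exp (- 3 / 4 * ln c) * exp (- 2 / 5 * real n) * (1 + 1 / (C1 * c))"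
    using \<tau> \<tau>0 \<tau>1 \<eta> C by (intro add_mono mult_mono) auto
  then have "real n ^ 2 * (\<tau> + \<eta> * (1 + \<tau>)) \<le> real n ^ 2 * (1 / (C1 * c) * exp (- real n / 2) + C2 * exp (- 3 / 4 * ln c) * exp (- 2 / 5 * real n) * (1 + 1 / (C1 * c)))"
    by (rule mult_left_mono) simp
  then show ?thesis by (simp add: power2_eq_square algebra_simps)
qed

theorem theorem4p2:
  fixes V0 :: "nat \<Rightarrow> nat set"
    and p :: "nat \<Rightarrow> nat"
    and M :: "nat \<Rightarrow> 'w measure"
    and y :: "nat \<Rightarrow> nat \<Rightarrow> 'w \<Rightarrow> (nat \<Rightarrow> real)"
    and \<mu> :: "nat \<Rightarrow> nat \<Rightarrow> (nat \<Rightarrow> real)"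
    and \<Sigma> :: "nat \<Rightarrow> nat \<Rightarrow> real mat"
    and r :: "nat \<Rightarrow> (nat \<Rightarrow> real) \<Rightarrow> real"
    and \<sigma> \<delta> lam \<rho> :: "nat \<Rightarrow> real"
    and \<iota> :: real
  assumes partition: "oracle_family V0"
    and dim_pos: "\<And>n. p n \<ge> 1"
    and dim_slow: "(\<lambda>n. real (p n)) \<in> o(\<lambda>n. real n)"
    and sigma_pos: "\<And>n. \<sigma> n > 0"
    and delta_pos: "\<And>n. \<delta> n > 0"
    and lambda_pos: "\<And>n. lam n > 0"
    and root_measurable: "\<And>n. r n \<in> borel_measurable (euclid (p n))"
    and root_pos: "\<And>n x. x \<in> space (euclid (p n)) \<Longrightarrow> r n x > 0"
    and cov_pos_def: "\<And>n k. k \<in> {1..K0 V0 n} \<Longrightarrow> pos_def_mat (p n) (\<Sigma> n k)"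
    and prob: "\<And>n. prob_space (M n)"
    and indep: "\<And>n. prob_space.indep_vars (M n) (\<lambda>_. euclid (p n)) (y n) {1..n}"
    and gaussian: "\<And>n k i. k \<in> {1..K0 V0 n} \<Longrightarrow> i \<in> oracle_block V0 n k \<Longrightarrow>
          distributed (M n) (euclid (p n)) (y n i)
            (\<lambda>x. ennreal (mvn_density (p n) (\<mu> n k) (\<Sigma> n k) x))"
    and rho_def: "\<And>n. \<rho> n = 1 / (\<delta> n * lam n * \<sigma> n ^ p n)"
    and i_root: "\<exists>C1>0. \<exists>C2>0. \<forall>\<^sub>F n in sequentially. AE \<omega> in M n.
          C1 * \<delta> n \<le> (MIN i\<in>{1..n}. r n (y n i \<omega>)) \<and>
          (MAX i\<in>{1..n}. r n (y n i \<omega>)) \<le> C2 * \<delta> n"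
    and i_K0: "(\<lambda>n. real (K0 V0 n)) \<in> o(\<lambda>n. sqrt (real n))"
    and iota_pos: "\<iota> > 0"
    and ii: "\<exists>c>0. \<forall>\<^sub>F n in sequentially. \<rho> n \<ge> c * (real (K0 V0 n) + 1 + \<iota>) ^ n"
    and iii: "(\<lambda>n. ereal ((\<sigma> n)\<^sup>2 * ln (\<rho> n)) / (D_min (p n) (K0 V0 n) (\<mu> n))\<^sup>2)
          \<longlonglongrightarrow> 0"
    and iv: "(\<lambda>n. \<Lambda>_max (K0 V0 n) (\<Sigma> n) * max (real (p n)) (ln (real n))
            / ((\<sigma> n)\<^sup>2 * ln (\<rho> n))) \<longlonglongrightarrow> 0"
  shows "(\<lambda>n. \<integral>\<omega>. bsf_prob_not_equiv n (p n) (\<sigma> n) (lam n) (r n) (\<lambda>i. y n i \<omega>)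
            (oracle_partition V0 n) \<partial>M n) \<longlonglongrightarrow> 0"
proof -
  obtain C1 C2 where C: "C1 > 0" "C2 > 0" and root: "\<forall>\<^sub>F n in sequentially. AE \<omega> in M n.
      C1 * \<delta> n \<le> (MIN i\<in>{1..n}. r n (y n i \<omega>)) \<and> (MAX i\<in>{1..n}. r n (y n i \<omega>)) \<le> C2 * \<delta> n"
    using i_root by blast
  obtain c where c: "c > 0" and c_ev: "\<forall>\<^sub>F n in sequentially. \<rho> n \<ge> c * (real (K0 V0 n) + 1 + \<iota>) ^ n"
    using ii by blast
  \<comment> \<open>The summand \<open>1 / n\<close> bounds the probability of the bad event, the
    rest the posterior error off it.\<close>
  define U where "U n = 1 / real n + real n ^ 2 * (1 / (C1 * c) * exp (- real n / 2) +
      C2 * exp (- 3 / 4 * ln c) * exp (- 2 / 5 * real n) * (1 + 1 / (C1 * c)))" for n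
  let ?I = "\<lambda>n. \<integral>\<omega>. bsf_prob_not_equiv n (p n) (\<sigma> n) (lam n) (r n) (\<lambda>i. y n i \<omega>) (oracle_partition V0 n) \<partial>M n"
  have U: "U \<longlonglongrightarrow> 0"
  proof -
    have "(\<lambda>n. 1 / real n) \<longlonglongrightarrow> 0" by real_asymp
    moreover have "(\<lambda>n. real n ^ 2 * exp (- real n / 2)) \<longlonglongrightarrow> 0" by real_asymp
    moreover have "(\<lambda>n. real n ^ 2 * exp (- 2 / 5 * real n)) \<longlonglongrightarrow> 0" by real_asymp
    ultimately have "(\<lambda>n. 1 / real n + (1 / (C1 * c) * (real n ^ 2 * exp (- real n / 2)) +
        C2 * exp (- 3 / 4 * ln c) * (1 + 1 / (C1 * c)) * (real n ^ 2 * exp (- 2 / 5 * real n)))) \<longlonglongrightarrow> 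
        0 + (1 / (C1 * c) * 0 + C2 * exp (- 3 / 4 * ln c) * (1 + 1 / (C1 * c)) * 0)"
      by (intro tendsto_intros)
    moreover have "U = (\<lambda>n. 1 / real n + (1 / (C1 * c) * (real n ^ 2 * exp (- real n / 2)) +
        C2 * exp (- 3 / 4 * ln c) * (1 + 1 / (C1 * c)) * (real n ^ 2 * exp (- 2 / 5 * real n))))"
      by (rule ext) (simp add: U_def distrib_left mult_ac)
    ultimately show ?thesis by simp
  qed
  \<comment> \<open>The thresholds 1/20, 1/25 and 1/128 are those consumed by
    \<open>ratio_bound_le\<close>, \<open>D_min_separation\<close> and
    \<open>tail_bound_le\<close>.\<close>
  have p_ev: "\<forall>\<^sub>F n in sequentially. real (p n) \<le> real n / 20"
    using landau_o.smallD[OF dim_slow, of "1 / 20"] by (auto elim: eventually_mono)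
  have iii_ev: "\<forall>\<^sub>F n in sequentially. ereal ((\<sigma> n)\<^sup>2 * ln (\<rho> n)) / (D_min (p n) (K0 V0 n) (\<mu> n))\<^sup>2 < ereal (1 / 25)"
    by (rule order_tendstoD(2)[OF iii]) simp
  have iv_ev: "\<forall>\<^sub>F n in sequentially. \<Lambda>_max (K0 V0 n) (\<Sigma> n) * max (real (p n)) (ln (real n)) / ((\<sigma> n)\<^sup>2 * ln (\<rho> n)) < 1 / 128"
    by (rule order_tendstoD(2)[OF iv]) simp
  \<comment> \<open>Used to force \<open>\<rho> n > 1\<close>, so that \<open>ln (\<rho> n)\<close>
    is positive.\<close>
  have big_ev: "\<forall>\<^sub>F n in sequentially. 1 < c * 2 ^ n"
  proof -
    have "filterlim (\<lambda>n. c * 2 ^ n :: real) at_top sequentially" using c by real_asymp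
    then show ?thesis by (simp add: filterlim_at_top_dense)
  qed
  have "\<forall>\<^sub>F n in sequentially. 0 \<le> ?I n \<and> ?I n \<le> U n"
    using root c_ev p_ev iii_ev iv_ev big_ev eventually_ge_at_top[of 1]
  proof eventually_elim
    case (elim n)
    let ?K = "K0 V0 n" and ?L = "\<Lambda>_max (K0 V0 n) (\<Sigma> n)"
    obtain \<kappa> where K1: "1 \<le> ?K"
      and \<kappa>: "\<And>i. i \<in> {1..n} \<Longrightarrow> \<kappa> i \<in> {1..?K} \<and> i \<in> oracle_block V0 n (\<kappa> i)"
      and same: "\<And>i j V. V \<in> set (oracle_partition V0 n) \<Longrightarrow> i \<in> V \<Longrightarrow> j \<in> V \<Longrightarrow> \<kappa> i = \<kappa> j"
      and sep: "\<And>i j. i \<in> {1..n} \<Longrightarrow> j \<in> {1..n} \<Longrightarrow> \<kappa> i = \<kappa> j \<Longrightarrow> \<exists>V. V \<in> set (oracle_partition V0 n) \<and> i \<in> V \<and> j \<in> V"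
      by (rule oracle_partition_facts[OF partition elim(7)], rule that)
    \<comment> \<open>There is at least one oracle block, so the base in (ii) exceeds 2.\<close>
    have "c * 2 ^ n \<le> c * (real ?K + 1 + \<iota>) ^ n"
      using c K1 iota_pos by (intro mult_left_mono power_mono) auto
    then have \<rho>2: "c * 2 ^ n \<le> \<rho> n" using elim(2) by linarith
    then have \<rho>1: "1 < \<rho> n" using elim(6) by linarith
    have q: "0 < (\<sigma> n)\<^sup>2 * ln (\<rho> n)" using sigma_pos[of n] \<rho>1 by simp
    have p0: "0 < p n" using dim_pos[of n] by simp
    have Lk: "max_eigenvalue (\<Sigma> n k) \<le> ?L" if "k \<in> {1..?K}" for k
      unfolding \<Lambda>_max_def using that by (intro Max_ge) auto
    have "0 < max_eigenvalue (\<Sigma> n 1)" using K1 by (intro max_eigenvalue_bound(1)[OF p0 cov_pos_def]) auto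
    then have L0: "0 < ?L" using Lk[of 1] K1 by simp
    have rt: "AE \<omega> in M n. \<forall>i\<in>{1..n}. C1 * \<delta> n \<le> r n (y n i \<omega>) \<and> r n (y n i \<omega>) \<le> C2 * \<delta> n"
      using elim(1)
    proof (rule AE_mp, intro AE_I2 impI ballI)
      fix \<omega> i assume h: "C1 * \<delta> n \<le> (MIN i\<in>{1..n}. r n (y n i \<omega>)) \<and> (MAX i\<in>{1..n}. r n (y n i \<omega>)) \<le> C2 * \<delta> n"
        and i: "i \<in> {1..n}"
      have "(MIN i\<in>{1..n}. r n (y n i \<omega>)) \<le> r n (y n i \<omega>)" "r n (y n i \<omega>) \<le> (MAX i\<in>{1..n}. r n (y n i \<omega>))"
        using i by (auto intro!: Min_le Max_ge)
      then show "C1 * \<delta> n \<le> r n (y n i \<omega>) \<and> r n (y n i \<omega>) \<le> C2 * \<delta> n" using h by linarith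
    qed
    have sepd: "25 * ((\<sigma> n)\<^sup>2 * ln (\<rho> n)) \<le> (euclid_dist (p n) (\<mu> n (\<kappa> i)) (\<mu> n (\<kappa> j)))\<^sup>2"
      if ij: "i \<in> {1..n}" "j \<in> {1..n}" "\<nexists>V. V \<in> set (oracle_partition V0 n) \<and> i \<in> V \<and> j \<in> V" for i j
    proof (rule D_min_separation[OF elim(4) q])
      show "\<kappa> i \<in> {1..?K}" "\<kappa> j \<in> {1..?K}" using \<kappa> ij by auto
      show "\<kappa> i \<noteq> \<kappa> j" using sep[OF ij(1,2)] ij(3) by blast
    qed
    have pd: "pos_def_mat (p n) (\<Sigma> n (\<kappa> i))"
      and D: "distributed (M n) (euclid (p n)) (y n i) (\<lambda>x. ennreal (mvn_density (p n) (\<mu> n (\<kappa> i)) (\<Sigma> n (\<kappa> i)) x))"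
      and L: "max_eigenvalue (\<Sigma> n (\<kappa> i)) \<le> ?L" if "i \<in> {1..n}" for i
      using \<kappa>[OF that] by (auto intro: cov_pos_def gaussian Lk simp del: atLeastAtMost_iff)
    have same_mean: "\<mu> n (\<kappa> i) = \<mu> n (\<kappa> j)"
      if "V \<in> set (oracle_partition V0 n)" "i \<in> V" "j \<in> V" for V i j
      by (simp only: same[OF that])
    note B = expected_error_bound[where y = "y n" and m = "\<lambda>i. \<mu> n (\<kappa> i)" and S = "\<lambda>i. \<Sigma> n (\<kappa> i)" and L = ?L,
      OF p0 sigma_pos delta_pos lambda_pos rho_def \<rho>1 prob C oracle_partition_in_ordered_partitions[OF partition]
        root_pos rt pd D L same_mean sepd]
    have "?I n \<le> real n * (sqrt 2 ^ p n * exp (- ((\<sigma> n)\<^sup>2 * ln (\<rho> n)) / (32 * ?L))) +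
       real n * (real n * (1 / (C1 * \<rho> n)) + real n * (C2 * sqrt (2 * pi) ^ p n * exp (- 3 / 4 * ln (\<rho> n))) * (1 + 1 / (C1 * \<rho> n)))"
      by (rule B(2))
    also have "\<dots> \<le> U n"
      unfolding U_def using elim(5)
      by (intro add_mono tail_bound_le[OF q L0 elim(7)] ratio_bound_le[OF c \<rho>2 C elim(3)]) simp
    finally have "?I n \<le> U n" .
    with B(1) show ?case by (rule conjI)
  qed
  then have "\<forall>\<^sub>F n in sequentially. 0 \<le> ?I n" "\<forall>\<^sub>F n in sequentially. ?I n \<le> U n"
    by (auto elim: eventually_mono)
  then show ?thesis by (rule tendsto_sandwich[OF _ _ tendsto_const U])
qed

end
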